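(* Let $G$ be a finite simple biconnected graph which is complete intersection. Then every minimal generator of $I_G$ is (up to sign) of the form $B_w$ where $w$ is an even cycle of $G$.
   Context: A graph is biconnected if it is connected and has no cut vertex. For a finite simple graph $G$ with edges $e_1,\dots,e_m$ and a field $K$, the toric ideal $I_G\subseteq K[e_1,\dots,e_m]$ is the kernel of the $K$-algebra map $e_i=\{v_j,v_k\}\mapsto v_jv_k$; $G$ is complete intersection if $I_G$ is generated by $\operatorname{ht}(I_G)$ elements. A minimal generator of $I_G$ is a binomial belonging to at least one minimal system of binomial generators of $I_G$. For an even cycle $w=(e_{i_1},\dots,e_{i_{2q}})$ (edges listed in order), $B_w=\prod_{k=1}^q e_{i_{2k-1}}-\prod_{k=1}^q e_{i_{2k}}$. *)

theory Defs
  imports "HOL-Library.Poly_Mapping" "HOL-Library.Extended_Nat"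
begin

definition is_ideal :: "'a::comm_ring_1 set \<Rightarrow> bool" where
  "is_ideal J \<longleftrightarrow> 0 \<in> J \<and> (\<forall>x\<in>J. \<forall>y\<in>J. x + y \<in> J) \<and> (\<forall>r. \<forall>x\<in>J. r * x \<in> J)"

definition ideal_gen :: "'a::comm_ring_1 set \<Rightarrow> 'a set" where
  "ideal_gen S = \<Inter>{J. is_ideal J \<and> S \<subseteq> J}"

definition prime_ideal :: "'a::comm_ring_1 set \<Rightarrow> bool" where
  "prime_ideal P \<longleftrightarrow> is_ideal P \<and> P \<noteq> UNIV \<and> (\<forall>a b. a * b \<in> P \<longrightarrow> a \<in> P \<or> b \<in> P)"

definition prime_height :: "'a::comm_ring_1 set \<Rightarrow> enat" where
  "prime_height P = Sup {enat n | n. \<exists>c :: nat \<Rightarrow> 'a set.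
      (\<forall>i\<le>n. prime_ideal (c i)) \<and> (\<forall>i<n. c i \<subset> c (Suc i)) \<and> c n = P}"

definition height :: "'a::comm_ring_1 set \<Rightarrow> enat" where
  "height I = Inf {prime_height P | P. prime_ideal P \<and> I \<subseteq> P}"

type_synonym ('x, 'k) mpol = "('x \<Rightarrow>\<^sub>0 nat) \<Rightarrow>\<^sub>0 'k"

definition Var :: "'x \<Rightarrow> ('x, 'k::comm_ring_1) mpol" where
  "Var x = Poly_Mapping.single (Poly_Mapping.single x 1) 1"

definition monom :: "('x \<Rightarrow>\<^sub>0 nat) \<Rightarrow> ('x, 'k::comm_ring_1) mpol" where
  "monom a = Poly_Mapping.single a 1"

definition is_binomial :: "('x, 'k::comm_ring_1) mpol \<Rightarrow> bool" where
  "is_binomial f \<longleftrightarrow> (\<exists>u v. f = monom u - monom v)"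

text \<open>A finite simple graph: vertex type 'v (finite), edge type 'e (finite),
  ends e = the two endpoints of edge e; ends injective (no multiple edges).\<close>
definition simple_graph :: "('e::finite \<Rightarrow> 'v::finite set) \<Rightarrow> bool" where
  "simple_graph ends \<longleftrightarrow> inj ends \<and> (\<forall>e. card (ends e) = 2)"

definition reach_in :: "('e \<Rightarrow> 'v set) \<Rightarrow> 'v set \<Rightarrow> 'v \<Rightarrow> 'v \<Rightarrow> bool" where
  "reach_in ends W u w \<longleftrightarrow> (\<exists>p. p \<noteq> [] \<and> hd p = u \<and> last p = w \<and> set p \<subseteq> W \<and>
      (\<forall>i. Suc i < length p \<longrightarrow> (\<exists>e. ends e = {p ! i, p ! Suc i})))"

definition connected_on :: "('e \<Rightarrow> 'v set) \<Rightarrow> 'v set \<Rightarrow> bool" where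
  "connected_on ends W \<longleftrightarrow> W \<noteq> {} \<and> (\<forall>u\<in>W. \<forall>w\<in>W. reach_in ends W u w)"

definition cut_vertex :: "('e \<Rightarrow> 'v set) \<Rightarrow> 'v \<Rightarrow> bool" where
  "cut_vertex ends v \<longleftrightarrow> \<not> connected_on ends (UNIV - {v})"

definition biconnected :: "('e \<Rightarrow> 'v set) \<Rightarrow> bool" where
  "biconnected ends \<longleftrightarrow> connected_on ends UNIV \<and> (\<forall>v. \<not> cut_vertex ends v)"

text \<open>image of the exponent vector of e_1^a_1...e_m^a_m under e={j,k} -> v_j v_k\<close>
definition toric_exp :: "('e::finite \<Rightarrow> 'v::finite set) \<Rightarrow> ('e \<Rightarrow>\<^sub>0 nat) \<Rightarrow> ('v \<Rightarrow>\<^sub>0 nat)" where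
  "toric_exp ends a = Abs_poly_mapping (\<lambda>v. \<Sum>e | v \<in> ends e. Poly_Mapping.lookup a e)"

definition toric_map :: "('e::finite \<Rightarrow> 'v::finite set) \<Rightarrow> ('e, 'k::comm_ring_1) mpol \<Rightarrow> ('v, 'k) mpol" where
  "toric_map ends f = (\<Sum>a\<in>Poly_Mapping.keys f. Poly_Mapping.single (toric_exp ends a) (Poly_Mapping.lookup f a))"

definition toric_ideal :: "('e::finite \<Rightarrow> 'v::finite set) \<Rightarrow> ('e, 'k::field) mpol set" where
  "toric_ideal ends = {f. toric_map ends f = 0}"

definition complete_intersection :: "('e::finite \<Rightarrow> 'v::finite set) \<Rightarrow> 'k::field itself \<Rightarrow> bool" where
  "complete_intersection ends TYPE('k) \<longleftrightarrow>
     (\<exists>S :: ('e, 'k) mpol set. finite S \<and> ideal_gen S = toric_ideal ends \<and>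
        enat (card S) = height (toric_ideal ends :: ('e, 'k) mpol set))"

definition minimal_generator :: "('e::finite \<Rightarrow> 'v::finite set) \<Rightarrow> ('e, 'k::field) mpol \<Rightarrow> bool" where
  "minimal_generator ends f \<longleftrightarrow>
     (\<exists>S. f \<in> S \<and> (\<forall>g\<in>S. is_binomial g) \<and> ideal_gen S = toric_ideal ends \<and>
          (\<forall>T. T \<subset> S \<longrightarrow> ideal_gen T \<noteq> toric_ideal ends))"

definition even_cycle :: "('e \<Rightarrow> 'v set) \<Rightarrow> 'e list \<Rightarrow> bool" where
  "even_cycle ends es \<longleftrightarrow> even (length es) \<and> length es \<ge> 4 \<and>
     (\<exists>vs. length vs = length es \<and> distinct vs \<and>
        (\<forall>i<length es. ends (es ! i) = {vs ! i, vs ! ((i + 1) mod length es)}))"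

definition B_cycle :: "'e list \<Rightarrow> ('e, 'k::comm_ring_1) mpol" where
  "B_cycle es = prod_list (map (\<lambda>i. Var (es ! i)) (filter even [0..<length es]))
              - prod_list (map (\<lambda>i. Var (es ! i)) (filter odd [0..<length es]))"

end

theory Submission
  imports Defs
begin

text \<open>
  Let \<open>T\<close> be a minimal binomial generating set containing \<open>f\<close>. By graded Nakayama
  \<open>T\<close> has at most \<open>ht I\<^sub>G\<close> elements, and \<open>ht I\<^sub>G\<close> is at most the rank of the lattice
  \<open>L\<close> of integer edge weights with vanishing sum at every vertex; so no proper subset of the
  exponent vectors of \<open>T\<close> spans \<open>L\<close>. Suppose \<open>f\<close> has degree at least 2 at
  a vertex \<open>a\<close>. As \<open>G - a\<close> is connected, \<open>L\<close> is generated by vectors of degree at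
  most 1 at \<open>a\<close>: two edges at \<open>a\<close> are completed by an alternating walk in
  \<open>G - a\<close>. The corresponding binomials are connected by moves from \<open>T\<close> that stay in a
  fiber of degree at most 1 at \<open>a\<close> and hence avoid \<open>f\<close>, so \<open>T - {f}\<close> already spans
  \<open>L\<close>, a contradiction. Therefore both monomials of \<open>f\<close> are matchings on the same vertices;
  their union contains an alternating even cycle, which is all of \<open>f\<close> by minimality.
\<close>

text \<open>The contradiction is a strict count, \<open>card T \<le> card S = height (toric_ideal
  ends) \<le> card UNIV - card Y \<le> card (T - {f})\<close>, where \<open>Y\<close> is a maximal
  set of edges that supports no nonzero vector of the lattice. The height is bounded from above
  through chains of primes: each step down a chain leaves room for one more variable that is
  independent modulo the prime, and the variables in \<open>Y\<close> are independent modulo the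
  toric ideal itself.

  The delicate point is parity. Two edges at \<open>a\<close> are completed to a lattice vector by a
  walk in \<open>G - a\<close> between their far ends only if the walk has even length. If
  \<open>G - a\<close> has an odd cycle, the parity can be corrected along it. If
  \<open>G - a\<close> is bipartite, the edges at \<open>a\<close> fall into two classes according
  to the side of their far end, and the vanishing vertex sums force the weights at \<open>a\<close>
  to cancel within each class.\<close>

abbreviation "lookup \<equiv> Poly_Mapping.lookup"
abbreviation "single \<equiv> Poly_Mapping.single"
abbreviation "keys \<equiv> Poly_Mapping.keys"

section \<open>Ideals\<close>

lemma is_ideal_zero: "is_ideal J \<Longrightarrow> 0 \<in> J"
  by (simp add: is_ideal_def)

lemma is_ideal_add: "is_ideal J \<Longrightarrow> x \<in> J \<Longrightarrow> y \<in> J \<Longrightarrow> x + y \<in> J"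
  by (simp add: is_ideal_def)

lemma is_ideal_mult: "is_ideal J \<Longrightarrow> x \<in> J \<Longrightarrow> r * x \<in> J"
  by (simp add: is_ideal_def)

lemma is_ideal_uminus: "is_ideal J \<Longrightarrow> x \<in> J \<Longrightarrow> - x \<in> J"
  using is_ideal_mult[of J x "-1"] by simp

lemma is_ideal_diff: "is_ideal J \<Longrightarrow> x \<in> J \<Longrightarrow> y \<in> J \<Longrightarrow> x - y \<in> J"
  using is_ideal_add[of J x "- y"] is_ideal_uminus[of J y] by simp

lemma is_ideal_sum: "is_ideal J \<Longrightarrow> (\<And>i. i \<in> I \<Longrightarrow> x i \<in> J) \<Longrightarrow> sum x I \<in> J"
  by (induction I rule: infinite_finite_induct) (auto intro: is_ideal_zero is_ideal_add)

lemma is_ideal_ideal_gen: "is_ideal (ideal_gen S)"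
  by (auto simp: ideal_gen_def is_ideal_def)

lemma subset_ideal_gen: "S \<subseteq> ideal_gen S"
  by (auto simp: ideal_gen_def)

lemma ideal_gen_least: "is_ideal J \<Longrightarrow> S \<subseteq> J \<Longrightarrow> ideal_gen S \<subseteq> J"
  by (auto simp: ideal_gen_def)

lemma ideal_gen_finite_combination:
  assumes "finite S" and "x \<in> ideal_gen S"
  obtains p where "x = (\<Sum>s\<in>S. p s * s)"
proof -
  let ?J = "{x. \<exists>p. x = (\<Sum>s\<in>S. p s * s)}"
  have "is_ideal ?J"
    unfolding is_ideal_def
  proof (intro conjI ballI allI)
    show "0 \<in> ?J"
      by (auto intro: exI[of _ "\<lambda>_. 0"])
  next
    fix x y assume "x \<in> ?J" and "y \<in> ?J"
    then obtain p q where "x = (\<Sum>s\<in>S. p s * s)" and "y = (\<Sum>s\<in>S. q s * s)"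
      by auto
    then have "x + y = (\<Sum>s\<in>S. (p s + q s) * s)"
      by (simp add: distrib_right sum.distrib)
    then show "x + y \<in> ?J"
      by (intro CollectI exI)
  next
    fix r x assume "x \<in> ?J"
    then obtain p where "x = (\<Sum>s\<in>S. p s * s)"
      by auto
    then have "r * x = (\<Sum>s\<in>S. (r * p s) * s)"
      by (simp add: sum_distrib_left mult.assoc)
    then show "r * x \<in> ?J"
      by (intro CollectI exI)
  qed
  moreover have "S \<subseteq> ?J"
  proof
    fix t assume "t \<in> S"
    then have "t = (\<Sum>s\<in>S. (if s = t then 1 else 0) * s)"
      using \<open>finite S\<close> by (simp add: if_distrib[of "\<lambda>c. c * _"] sum.delta cong: if_cong)
    then show "t \<in> ?J"
      by (intro CollectI exI)
  qed
  ultimately show thesis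
    using assms(2) ideal_gen_least[of ?J S] that by blast
qed

section \<open>Linear dependence over a domain\<close>

text \<open>Stated for sets, so that one elimination lemma serves the polynomials in some of the
  variables, the coefficient field and the integers.\<close>

definition subring :: "'a::comm_ring_1 set \<Rightarrow> bool" where
  "subring R \<longleftrightarrow> 1 \<in> R \<and> (\<forall>x\<in>R. \<forall>y\<in>R. x - y \<in> R) \<and> (\<forall>x\<in>R. \<forall>y\<in>R. x * y \<in> R)"

lemma subring_one: "subring R \<Longrightarrow> 1 \<in> R"
  and subring_diff: "subring R \<Longrightarrow> x \<in> R \<Longrightarrow> y \<in> R \<Longrightarrow> x - y \<in> R"
  and subring_mult: "subring R \<Longrightarrow> x \<in> R \<Longrightarrow> y \<in> R \<Longrightarrow> x * y \<in> R"
  by (auto simp: subring_def)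

lemma subring_zero: "subring R \<Longrightarrow> 0 \<in> R"
  using subring_diff[of R 1 1] subring_one[of R] by simp

lemma subring_uminus: "subring R \<Longrightarrow> x \<in> R \<Longrightarrow> - x \<in> R"
  using subring_diff[of R 0 x] subring_zero[of R] by simp

lemma subring_add: "subring R \<Longrightarrow> x \<in> R \<Longrightarrow> y \<in> R \<Longrightarrow> x + y \<in> R"
  using subring_diff[of R x "- y"] subring_uminus[of R y] by simp

lemma subring_sum: "subring R \<Longrightarrow> (\<And>i. i \<in> I \<Longrightarrow> x i \<in> R) \<Longrightarrow> sum x I \<in> R"
  by (induction I rule: infinite_finite_induct) (auto intro: subring_zero subring_add)

text \<open>Induction on the equations by fraction-free elimination: cross-multiplication with a
  pivot row removes one equation and one unknown without any division.\<close>

lemma homogeneous_system_nontrivial_solution: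
  fixes M :: "'i \<Rightarrow> 'j \<Rightarrow> 'a::comm_ring_1"
  assumes R: "subring R" and dom: "\<And>x y. x \<in> R \<Longrightarrow> y \<in> R \<Longrightarrow> x * y = 0 \<Longrightarrow> x = 0 \<or> y = 0"
    and "finite J" and "finite I" and "card J < card I"
    and "\<And>i j. i \<in> I \<Longrightarrow> j \<in> J \<Longrightarrow> M i j \<in> R"
  shows "\<exists>c. (\<forall>i\<in>I. c i \<in> R) \<and> (\<exists>i\<in>I. c i \<noteq> 0) \<and> (\<forall>j\<in>J. (\<Sum>i\<in>I. c i * M i j) = 0)"
  using assms(3-)
proof (induction J arbitrary: I M rule: finite_induct)
  case empty
  then have "I \<noteq> {}"
    by auto
  then show ?case
    using subring_one[OF R] by (intro exI[of _ "\<lambda>_. 1"]) auto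
next
  case (insert j J)
  show ?case
  proof (cases "\<forall>i\<in>I. M i j = 0")
    case True
    have "\<exists>c. (\<forall>i\<in>I. c i \<in> R) \<and> (\<exists>i\<in>I. c i \<noteq> 0) \<and> (\<forall>j\<in>J. (\<Sum>i\<in>I. c i * M i j) = 0)"
      using insert.prems insert.hyps by (intro insert.IH) auto
    then show ?thesis
      using True by auto
  next
    case False
    then obtain k where k: "k \<in> I" "M k j \<noteq> 0"
      by auto
    define N where "N i l = M k j * M i l - M i j * M k l" for i l
    have "\<exists>c. (\<forall>i\<in>I - {k}. c i \<in> R) \<and> (\<exists>i\<in>I - {k}. c i \<noteq> 0) \<and>
        (\<forall>l\<in>J. (\<Sum>i\<in>I - {k}. c i * N i l) = 0)"
      using insert.prems insert.hyps k R unfolding N_def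
      by (intro insert.IH) (auto intro!: subring_diff subring_mult)
    then obtain c where c: "\<And>i. i \<in> I - {k} \<Longrightarrow> c i \<in> R" "\<exists>i\<in>I - {k}. c i \<noteq> 0"
        "\<And>l. l \<in> J \<Longrightarrow> (\<Sum>i\<in>I - {k}. c i * N i l) = 0"
      by blast
    \<comment> \<open>Scaling the other unknowns by the pivot \<open>M k j\<close> lets equation
      \<open>j\<close> be solved for the unknown \<open>k\<close> inside \<open>R\<close>.\<close>
    define d where "d i = (if i = k then - (\<Sum>i\<in>I - {k}. c i * M i j) else c i * M k j)" for i
    have sum_d: "(\<Sum>i\<in>I. d i * M i l) = (\<Sum>i\<in>I - {k}. c i * N i l)" for l
    proof -
      have "(\<Sum>i\<in>I. d i * M i l) = d k * M k l + (\<Sum>i\<in>I - {k}. d i * M i l)"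
        using k(1) insert.prems(1) by (simp add: sum.remove)
      also have "(\<Sum>i\<in>I - {k}. d i * M i l) = (\<Sum>i\<in>I - {k}. c i * M k j * M i l)"
        by (rule sum.cong) (auto simp: d_def)
      also have "d k * M k l = - (\<Sum>i\<in>I - {k}. c i * M i j * M k l)"
        by (simp add: d_def sum_distrib_right)
      also have "- (\<Sum>i\<in>I - {k}. c i * M i j * M k l) + (\<Sum>i\<in>I - {k}. c i * M k j * M i l)
          = (\<Sum>i\<in>I - {k}. c i * N i l)"
        by (simp add: N_def algebra_simps flip: sum_subtractf)
      finally show ?thesis .
    qed
    have "\<forall>i\<in>I. d i \<in> R"
      using c(1) insert.prems k R unfolding d_def
      by (auto intro!: subring_mult subring_uminus subring_sum)
    moreover have "\<exists>i\<in>I. d i \<noteq> 0"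
    proof -
      obtain i where i: "i \<in> I - {k}" "c i \<noteq> 0"
        using c(2) by blast
      then have "c i * M k j \<noteq> 0"
        using dom[of "c i" "M k j"] c(1) insert.prems(3)[of k j] k by auto
      then show ?thesis
        using i by (auto simp: d_def)
    qed
    moreover have "(\<Sum>i\<in>I. d i * M i l) = 0" if "l \<in> insert j J" for l
    proof (cases "l = j")
      case True
      then show ?thesis
        by (simp add: sum_d N_def mult.commute)
    next
      case False
      then show ?thesis
        using that c(3) by (simp add: sum_d)
    qed
    ultimately show ?thesis
      by blast
  qed
qed

section \<open>Algebraicity over a subring meeting a prime trivially\<close>

text \<open>The span of \<open>B\<close> over the fraction field of \<open>R\<close>, taken modulo
  \<open>P\<close> and written with cleared denominators.\<close>

definition frac_span :: "'a::comm_ring_1 set \<Rightarrow> 'a set \<Rightarrow> 'a set \<Rightarrow> 'a set" where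
  "frac_span R P B = {x. \<exists>s r. s \<in> R \<and> s \<noteq> 0 \<and> (\<forall>b\<in>B. r b \<in> R) \<and> s * x - (\<Sum>b\<in>B. r b * b) \<in> P}"

text \<open>\<open>R_Int_P\<close> says that \<open>R\<close> embeds into the quotient by
  \<open>P\<close>. Hence \<open>R\<close> is a domain and its nonzero elements can serve as
  denominators modulo \<open>P\<close>.\<close>

locale subring_mod_prime =
  fixes R P :: "'a::comm_ring_1 set"
  assumes prime: "prime_ideal P" and subring: "subring R" and R_Int_P: "R \<inter> P \<subseteq> {0}"
begin

lemma ideal: "is_ideal P"
  using prime by (simp add: prime_ideal_def)

lemma no_zero_divisors: "x \<in> R \<Longrightarrow> y \<in> R \<Longrightarrow> x * y = 0 \<Longrightarrow> x = 0 \<or> y = 0"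
  using prime R_Int_P is_ideal_zero[OF ideal] unfolding prime_ideal_def by (metis IntI empty_iff insert_iff subsetD)

lemma one_neq_zero: "(1::'a) \<noteq> 0"
proof
  assume "(1::'a) = 0"
  then have "x \<in> P" for x
    using is_ideal_mult[OF ideal is_ideal_zero[OF ideal], of x] by (metis mult_1_right)
  then show False
    using prime by (auto simp: prime_ideal_def)
qed

lemma frac_span_base:
  assumes "finite B" and "b \<in> B"
  shows "b \<in> frac_span R P B"
proof -
  have "1 * b - (\<Sum>c\<in>B. (if c = b then 1 else 0) * c) = 0"
    using assms by (simp add: if_distrib[of "\<lambda>c. c * _"] sum.delta cong: if_cong)
  then have "1 * b - (\<Sum>c\<in>B. (if c = b then 1 else 0) * c) \<in> P"
    using is_ideal_zero[OF ideal] by simp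
  then show ?thesis
    unfolding frac_span_def mem_Collect_eq
    by (intro exI[of _ 1] exI[of _ "\<lambda>c. if c = b then 1 else 0"])
       (auto simp: subring_one[OF subring] subring_zero[OF subring] one_neq_zero)
qed

lemma frac_span_ideal: "x \<in> P \<Longrightarrow> x \<in> frac_span R P B"
  unfolding frac_span_def mem_Collect_eq
  by (intro exI[of _ 1] exI[of _ "\<lambda>_. 0"])
     (auto simp: subring_one[OF subring] subring_zero[OF subring] one_neq_zero)

lemma frac_span_add:
  assumes "x \<in> frac_span R P B" and "y \<in> frac_span R P B"
  shows "x + y \<in> frac_span R P B"
proof -
  obtain s r where s: "s \<in> R" "s \<noteq> 0" "\<forall>b\<in>B. r b \<in> R" "s * x - (\<Sum>b\<in>B. r b * b) \<in> P"
    using assms(1) by (auto simp: frac_span_def)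
  obtain t q where t: "t \<in> R" "t \<noteq> 0" "\<forall>b\<in>B. q b \<in> R" "t * y - (\<Sum>b\<in>B. q b * b) \<in> P"
    using assms(2) by (auto simp: frac_span_def)
  have "(s * t) * (x + y) - (\<Sum>b\<in>B. (t * r b + s * q b) * b)
      = t * (s * x - (\<Sum>b\<in>B. r b * b)) + s * (t * y - (\<Sum>b\<in>B. q b * b))"
    by (simp add: algebra_simps sum.distrib sum_distrib_left)
  also have "\<dots> \<in> P"
    using s(4) t(4) ideal by (intro is_ideal_add is_ideal_mult)
  finally have "(s * t) * (x + y) - (\<Sum>b\<in>B. (t * r b + s * q b) * b) \<in> P" .
  moreover have "s * t \<in> R" "s * t \<noteq> 0"
    using s t no_zero_divisors[of s t] by (auto intro: subring_mult[OF subring])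
  moreover have "\<forall>b\<in>B. t * r b + s * q b \<in> R"
    using s t by (auto intro!: subring_mult[OF subring] subring_add[OF subring])
  ultimately show ?thesis
    unfolding frac_span_def mem_Collect_eq
    by (intro exI[of _ "s * t"] exI[of _ "\<lambda>b. t * r b + s * q b"]) simp
qed

lemma frac_span_scale:
  assumes "x \<in> frac_span R P B" and "t \<in> R"
  shows "t * x \<in> frac_span R P B"
proof -
  obtain s r where s: "s \<in> R" "s \<noteq> 0" "\<forall>b\<in>B. r b \<in> R" "s * x - (\<Sum>b\<in>B. r b * b) \<in> P"
    using assms(1) by (auto simp: frac_span_def)
  have "s * (t * x) - (\<Sum>b\<in>B. (t * r b) * b) = t * (s * x - (\<Sum>b\<in>B. r b * b))"
    by (simp add: algebra_simps sum_distrib_left)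
  also have "\<dots> \<in> P"
    using s(4) ideal by (intro is_ideal_mult)
  finally have "s * (t * x) - (\<Sum>b\<in>B. (t * r b) * b) \<in> P" .
  moreover have "\<forall>b\<in>B. t * r b \<in> R"
    using s assms(2) by (auto intro!: subring_mult[OF subring])
  ultimately show ?thesis
    using s(1,2) unfolding frac_span_def mem_Collect_eq
    by (intro exI[of _ s] exI[of _ "\<lambda>b. t * r b"]) simp
qed

lemma frac_span_cancel:
  assumes "t * x \<in> frac_span R P B" and "t \<in> R" and "t \<noteq> 0"
  shows "x \<in> frac_span R P B"
proof -
  obtain s r where s: "s \<in> R" "s \<noteq> 0" "\<forall>b\<in>B. r b \<in> R" "s * (t * x) - (\<Sum>b\<in>B. r b * b) \<in> P"
    using assms(1) by (auto simp: frac_span_def)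
  have "s * t \<in> R" "s * t \<noteq> 0"
    using s assms no_zero_divisors[of s t] by (auto intro: subring_mult[OF subring])
  moreover have "(s * t) * x - (\<Sum>b\<in>B. r b * b) \<in> P"
    using s(4) by (simp only: mult.assoc)
  ultimately show ?thesis
    using s(3) unfolding frac_span_def by blast
qed

lemma frac_span_sum:
  "(\<And>i. i \<in> I \<Longrightarrow> x i \<in> frac_span R P B) \<Longrightarrow> sum x I \<in> frac_span R P B"
  by (induction I rule: infinite_finite_induct)
     (auto intro: frac_span_add frac_span_ideal is_ideal_zero[OF ideal])

lemma frac_span_mult:
  assumes "finite B" "finite C" and "x \<in> frac_span R P B" "y \<in> frac_span R P C"
  shows "x * y \<in> frac_span R P ((\<lambda>(b, c). b * c) ` (B \<times> C))" (is "_ \<in> frac_span R P ?D")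
proof -
  obtain s r where s: "s \<in> R" "s \<noteq> 0" "\<forall>b\<in>B. r b \<in> R" "s * x - (\<Sum>b\<in>B. r b * b) \<in> P"
    using assms(3) by (auto simp: frac_span_def)
  obtain t q where t: "t \<in> R" "t \<noteq> 0" "\<forall>b\<in>C. q b \<in> R" "t * y - (\<Sum>b\<in>C. q b * b) \<in> P"
    using assms(4) by (auto simp: frac_span_def)
  let ?u = "\<Sum>b\<in>B. r b * b" and ?v = "\<Sum>b\<in>C. q b * b"
  have "(s * t) * (x * y) = ?u * ?v + ((t * y) * (s * x - ?u) + ?u * (t * y - ?v))"
    by (simp add: algebra_simps)
  moreover have "?u * ?v \<in> frac_span R P ?D"
  proof -
    have "?u * ?v = (\<Sum>b\<in>B. \<Sum>c\<in>C. (r b * q c) * (b * c))"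
      unfolding sum_product by (intro sum.cong refl) (simp only: ac_simps)
    also have "\<dots> \<in> frac_span R P ?D"
      using s(3) t(3) assms(1,2)
      by (intro frac_span_sum frac_span_scale frac_span_base) (auto intro: subring_mult[OF subring])
    finally show ?thesis .
  qed
  moreover have "(t * y) * (s * x - ?u) + ?u * (t * y - ?v) \<in> P"
    using s(4) t(4) ideal by (intro is_ideal_add is_ideal_mult)
  ultimately have "(s * t) * (x * y) \<in> frac_span R P ?D"
    using frac_span_add frac_span_ideal by simp
  moreover have "s * t \<in> R" "s * t \<noteq> 0"
    using s t no_zero_divisors[of s t] by (auto intro: subring_mult[OF subring])
  ultimately show ?thesis
    using frac_span_cancel by blast
qed

text \<open>The relation makes \<open>x\<close> algebraic over the fractions of \<open>R\<close>, so
  the span of the powers below \<open>n\<close> is stable under multiplication by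
  \<open>x\<close>.\<close>

lemma power_in_frac_span:
  assumes q: "\<And>i. i \<le> n \<Longrightarrow> q i \<in> R" "q n \<noteq> 0" and rel: "(\<Sum>i\<le>n. q i * x ^ i) \<in> P"
  shows "x ^ k \<in> frac_span R P ((^) x ` {..<n})" (is "_ \<in> frac_span R P ?B")
proof -
  have base: "x ^ i \<in> frac_span R P ?B" if "i < n" for i
    using that by (intro frac_span_base) auto
  have "q n * x ^ n = (\<Sum>i\<le>n. q i * x ^ i) + (\<Sum>i<n. (- q i) * x ^ i)"
    by (simp add: lessThan_Suc_atMost[symmetric] sum_negf)
  also have "\<dots> \<in> frac_span R P ?B"
  proof (rule frac_span_add)
    show "(\<Sum>i<n. (- q i) * x ^ i) \<in> frac_span R P ?B"
      using base q(1) by (intro frac_span_sum frac_span_scale subring_uminus[OF subring]) auto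
  qed (rule frac_span_ideal[OF rel])
  finally have top: "x ^ n \<in> frac_span R P ?B"
    using q frac_span_cancel by blast
  have step: "x * y \<in> frac_span R P ?B" if y: "y \<in> frac_span R P ?B" for y
  proof -
    obtain s r where s: "s \<in> R" "s \<noteq> 0" "\<forall>b\<in>?B. r b \<in> R" "s * y - (\<Sum>b\<in>?B. r b * b) \<in> P"
      using y unfolding frac_span_def by blast
    have *: "x * b \<in> frac_span R P ?B" if "b \<in> ?B" for b
    proof -
      from that obtain i where i: "i < n" "b = x ^ i"
        by auto
      then have "x * b = x ^ Suc i" and "Suc i < n \<or> Suc i = n"
        by auto
      then show ?thesis
        using base top by metis
    qed
    have "s * (x * y) = (\<Sum>b\<in>?B. r b * (x * b)) + x * (s * y - (\<Sum>b\<in>?B. r b * b))"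
      by (simp add: algebra_simps sum_distrib_left)
    also have "\<dots> \<in> frac_span R P ?B"
    proof (rule frac_span_add)
      show "(\<Sum>b\<in>?B. r b * (x * b)) \<in> frac_span R P ?B"
        using s(3) * by (blast intro: frac_span_sum frac_span_scale)
      show "x * (s * y - (\<Sum>b\<in>?B. r b * b)) \<in> frac_span R P ?B"
        by (rule frac_span_ideal[OF is_ideal_mult[OF ideal s(4)]])
    qed
    finally show ?thesis
      using s frac_span_cancel by blast
  qed
  \<comment> \<open>For \<open>n = 0\<close> the relation would put the nonzero element
    \<open>q 0\<close> of \<open>R\<close> into \<open>P\<close>.\<close>
  have "n \<noteq> 0"
    using rel q R_Int_P by (cases n) auto
  then have "x ^ 0 \<in> frac_span R P ?B"
    using base by blast
  then show ?thesis
    by (induction k) (use step in auto)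
qed

text \<open>A domain that is finite-dimensional over a field is itself a field, so a larger ideal
  \<open>Q\<close> must contain a nonzero element of \<open>R\<close>.\<close>

lemma frac_span_UNIV_imp_subset:
  assumes "finite B" and UNIV: "frac_span R P B = UNIV"
    and Q: "is_ideal Q" "P \<subseteq> Q" "R \<inter> Q \<subseteq> {0}"
  shows "Q \<subseteq> P"
proof (rule ccontr)
  assume "\<not> Q \<subseteq> P"
  then obtain x where x: "x \<in> Q" "x \<notin> P"
    by auto
  have "\<exists>s r. s \<in> R \<and> s \<noteq> 0 \<and> (\<forall>b\<in>B. r b \<in> R) \<and> s * x ^ i - (\<Sum>b\<in>B. r b * b) \<in> P" for i
    using UNIV by (auto simp: frac_span_def set_eq_iff)
  then obtain s r where s: "\<And>i. s i \<in> R" "\<And>i. s i \<noteq> 0" "\<And>i b. b \<in> B \<Longrightarrow> r i b \<in> R"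
      "\<And>i. s i * x ^ i - (\<Sum>b\<in>B. r i b * b) \<in> P"
    by metis
  \<comment> \<open>The \<open>n + 1\<close> powers \<open>x ^ 0\<close>, ..., \<open>x ^ n\<close>
    have to be dependent in a space spanned by \<open>n\<close> elements.\<close>
  define n where "n = card B"
  have "\<exists>c. (\<forall>i\<in>{..n}. c i \<in> R) \<and> (\<exists>i\<in>{..n}. c i \<noteq> 0) \<and> (\<forall>b\<in>B. (\<Sum>i\<in>{..n}. c i * r i b) = 0)"
    using subring no_zero_divisors assms(1) s
    by (intro homogeneous_system_nontrivial_solution) (auto simp: n_def)
  then obtain c where c: "\<And>i. i \<le> n \<Longrightarrow> c i \<in> R" "\<exists>i\<le>n. c i \<noteq> 0"
      "\<And>b. b \<in> B \<Longrightarrow> (\<Sum>i\<le>n. c i * r i b) = 0"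
    by auto
  have "(\<Sum>i\<le>n. (c i * s i) * x ^ i)
      = (\<Sum>i\<le>n. c i * (s i * x ^ i - (\<Sum>b\<in>B. r i b * b))) + (\<Sum>i\<le>n. \<Sum>b\<in>B. c i * r i b * b)"
    by (simp add: right_diff_distrib sum_subtractf sum_distrib_left mult.assoc)
  also have "(\<Sum>i\<le>n. \<Sum>b\<in>B. c i * r i b * b) = (\<Sum>b\<in>B. (\<Sum>i\<le>n. c i * r i b) * b)"
    by (subst sum.swap) (simp add: sum_distrib_right)
  also have "\<dots> = 0"
    using c(3) by simp
  also have "(\<Sum>i\<le>n. c i * (s i * x ^ i - (\<Sum>b\<in>B. r i b * b))) + 0 \<in> P"
    using s(4) by (auto intro!: is_ideal_sum[OF ideal] is_ideal_mult[OF ideal])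
  finally have rel: "(\<Sum>i\<le>n. (c i * s i) * x ^ i) \<in> P" .
  \<comment> \<open>The relation is divided by its lowest power of \<open>x\<close>, which is
    legitimate modulo the prime \<open>P\<close>. The lowest coefficient is then an element of
    \<open>R\<close> that lies in \<open>Q\<close>.\<close>
  define k where "k = (LEAST i. i \<le> n \<and> c i \<noteq> 0)"
  have k: "k \<le> n" "c k \<noteq> 0"
    using LeastI_ex[of "\<lambda>i. i \<le> n \<and> c i \<noteq> 0"] c(2) by (auto simp: k_def)
  have below: "c i = 0" if "i < k" for i
    using that not_less_Least[of i "\<lambda>i. i \<le> n \<and> c i \<noteq> 0"] k(1) by (auto simp: k_def)
  have "(\<Sum>i\<le>n. (c i * s i) * x ^ i) = (\<Sum>i\<in>{k..n}. (c i * s i) * x ^ i)"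
    by (rule sum.mono_neutral_right) (auto simp: below)
  also have "\<dots> = c k * s k * x ^ k + (\<Sum>i\<in>{Suc k..n}. (c i * s i) * x ^ i)"
    using k(1) by (rule sum.atLeast_Suc_atMost)
  also have "(\<Sum>i\<in>{Suc k..n}. (c i * s i) * x ^ i) = x ^ Suc k * (\<Sum>i\<in>{Suc k..n}. (c i * s i) * x ^ (i - Suc k))"
    unfolding sum_distrib_left
  proof (rule sum.cong[OF refl])
    fix i assume "i \<in> {Suc k..n}"
    then have "x ^ i = x ^ Suc k * x ^ (i - Suc k)"
      by (simp flip: power_add power_Suc)
    then show "c i * s i * x ^ i = x ^ Suc k * (c i * s i * x ^ (i - Suc k))"
      by (simp only: ac_simps)
  qed
  finally have "x ^ k * (c k * s k + x * (\<Sum>i\<in>{Suc k..n}. (c i * s i) * x ^ (i - Suc k))) \<in> P"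
    using rel by (simp add: algebra_simps)
  moreover have "x ^ k \<notin> P"
  proof (induction k)
    case 0
    show ?case
    proof
      assume "x ^ 0 \<in> P"
      then have "y \<in> P" for y
        using is_ideal_mult[OF ideal, of 1 y] by simp
      then show False
        using prime by (auto simp: prime_ideal_def)
    qed
  next
    case (Suc k)
    then show ?case
      using x(2) prime unfolding prime_ideal_def by auto
  qed
  ultimately have "c k * s k + x * (\<Sum>i\<in>{Suc k..n}. (c i * s i) * x ^ (i - Suc k)) \<in> Q"
    using prime Q(2) unfolding prime_ideal_def by blast
  moreover have "x * (\<Sum>i\<in>{Suc k..n}. (c i * s i) * x ^ (i - Suc k)) \<in> Q"
    by (subst mult.commute) (rule is_ideal_mult[OF Q(1) x(1)])
  ultimately have "c k * s k \<in> Q"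
    using is_ideal_diff[OF Q(1)] by fastforce
  moreover have "c k * s k \<in> R"
    using c(1)[OF k(1)] s(1) by (rule subring_mult[OF subring])
  ultimately have "c k * s k = 0"
    using Q(3) by auto
  then show False
    using no_zero_divisors[OF c(1)[OF k(1)] s(1)] k(2) s(2) by auto
qed

end

section \<open>Polynomials in a subset of the variables\<close>

lemma sum_single_lookup: "(\<Sum>a\<in>keys f. single a (lookup f a)) = f"
  by (rule poly_mapping_eqI) (auto simp: lookup_sum lookup_single when_def in_keys_iff)

lemma poly_mapping_induct_single [case_names zero single add]:
  fixes f :: "'a \<Rightarrow>\<^sub>0 'b::comm_monoid_add"
  assumes "P 0" and "\<And>a c. P (single a c)" and "\<And>f g. P f \<Longrightarrow> P g \<Longrightarrow> P (f + g)"
  shows "P f"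
proof -
  have "P (\<Sum>a\<in>A. single a (lookup f a))" for A
    by (induction A rule: infinite_finite_induct) (use assms in auto)
  then show ?thesis
    by (metis sum_single_lookup)
qed

definition vars_in :: "'x set \<Rightarrow> ('x, 'k::comm_ring_1) mpol set" where
  "vars_in Y = {p. \<forall>a\<in>keys p. keys a \<subseteq> Y}"

lemma subring_vars_in: "subring (vars_in Y)"
  unfolding subring_def
proof (intro conjI ballI)
  show "1 \<in> vars_in Y"
    by (simp add: vars_in_def)
next
  fix p q :: "('a, 'b) mpol" assume "p \<in> vars_in Y" and "q \<in> vars_in Y"
  note * = this[unfolded vars_in_def mem_Collect_eq]
  show "p - q \<in> vars_in Y"
    using * keys_diff[of p q] unfolding vars_in_def by blast
  have "keys c \<subseteq> Y" if "c \<in> keys (p * q)" for c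
  proof -
    obtain a b where "c = a + b" "a \<in> keys p" "b \<in> keys q"
      using \<open>c \<in> keys (p * q)\<close> keys_mult[of p q] by auto
    then show ?thesis
      using * keys_add[of a b] by blast
  qed
  then show "p * q \<in> vars_in Y"
    by (simp add: vars_in_def)
qed

lemma Var_power: "Var e ^ k = single (single e k) 1"
  by (induction k) (auto simp: Var_def mult_single simp flip: single_add)

lemma single_mult_Var_power: "single a c * Var e ^ k = single (a + single e k) c"
  by (simp add: Var_power mult_single)

text \<open>Turns a nonzero polynomial of an ideal into an algebraic equation for the variable
  \<open>e\<close>, in the shape that \<open>power_in_frac_span\<close> expects.\<close>

lemma expand_in_variable:
  fixes p :: "('x, 'k::comm_ring_1) mpol"
  assumes p: "p \<in> vars_in (insert e Y)" "p \<noteq> 0"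
  obtains q n where "\<And>k. q k \<in> vars_in Y" "q n \<noteq> 0" "p = (\<Sum>k\<le>n. q k * Var e ^ k)"
proof -
  define n where "n = Max ((\<lambda>a. lookup a e) ` keys p)"
  define q where "q k = (\<Sum>a\<in>{a \<in> keys p. lookup a e = k}. single (a - single e k) (lookup p a))" for k
  have q_mult: "q k * Var e ^ k = (\<Sum>a\<in>{a \<in> keys p. lookup a e = k}. single a (lookup p a))" for k
    unfolding q_def sum_distrib_right single_mult_Var_power
  proof (rule sum.cong[OF refl])
    fix a assume "a \<in> {a \<in> keys p. lookup a e = k}"
    then have "a - single e k + single e k = a"
      by (intro poly_mapping_eqI) (auto simp: lookup_add lookup_minus lookup_single when_def)
    then show "single (a - single e k + single e k) (lookup p a) = single a (lookup p a)"
      by simp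
  qed
  have "keys p \<noteq> {}"
    using p(2) by simp
  then have "n \<in> (\<lambda>a. lookup a e) ` keys p"
    unfolding n_def by (intro Max_in) auto
  then obtain a where a: "a \<in> keys p" "lookup a e = n"
    by auto
  have "lookup (q n * Var e ^ n) a = lookup p a"
    unfolding q_mult using a by (simp add: lookup_sum lookup_single when_def)
  then have "q n \<noteq> 0"
    using a by (auto simp: in_keys_iff)
  moreover have "q k \<in> vars_in Y" for k
    unfolding q_def
  proof (rule subring_sum[OF subring_vars_in])
    fix a assume a: "a \<in> {a \<in> keys p. lookup a e = k}"
    then have "keys a \<subseteq> insert e Y"
      using p(1) by (auto simp: vars_in_def)
    then have "\<And>x. lookup a x \<noteq> 0 \<Longrightarrow> e \<noteq> x \<Longrightarrow> x \<in> Y"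
      by (auto simp: in_keys_iff subset_iff)
    then have "keys (a - single e k) \<subseteq> Y"
      using a by (auto simp: in_keys_iff lookup_minus lookup_single when_def split: if_splits)
    then show "single (a - single e k) (lookup p a) \<in> vars_in Y"
      by (auto simp: vars_in_def)
  qed
  moreover have "p = (\<Sum>k\<le>n. q k * Var e ^ k)"
  proof -
    have "(\<Sum>k\<le>n. q k * Var e ^ k) = (\<Sum>a\<in>keys p. single a (lookup p a))"
      unfolding q_mult by (rule sum.group) (auto simp: n_def)
    then show ?thesis
      by (simp add: sum_single_lookup)
  qed
  ultimately show thesis
    using that by blast
qed

section \<open>Height of a prime in a polynomial ring\<close>

text \<open>If no variable could be added, every variable would be algebraic over those in
  \<open>Y\<close> modulo \<open>P\<close>. The quotient by \<open>P\<close> would then be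
  finite-dimensional over the fractions of \<open>vars_in Y\<close>, leaving no room for a larger
  ideal \<open>Q\<close> that avoids \<open>vars_in Y\<close>.\<close>

lemma indep_vars_extend:
  fixes P Q :: "('e::finite, 'k::comm_ring_1) mpol set"
  assumes P: "prime_ideal P" and Q: "is_ideal Q" and "P \<subset> Q" and Y: "vars_in Y \<inter> Q \<subseteq> {0}"
  shows "\<exists>e. e \<notin> Y \<and> vars_in (insert e Y) \<inter> P \<subseteq> {0}"
proof (rule ccontr)
  assume neg: "\<not> ?thesis"
  interpret subring_mod_prime "vars_in Y" P
    using P Y \<open>P \<subset> Q\<close> subring_vars_in by unfold_locales auto
  have powers: "\<exists>B. finite B \<and> (\<forall>k. Var e ^ k \<in> frac_span (vars_in Y) P B)" for e
  proof (cases "e \<in> Y")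
    case True
    have "Var e ^ k * 1 \<in> frac_span (vars_in Y) P {1}" for k
      using True by (intro frac_span_scale frac_span_base) (auto simp: Var_power vars_in_def)
    then show ?thesis
      by (intro exI[of _ "{1}"]) simp
  next
    case False
    then obtain p where p: "p \<in> vars_in (insert e Y)" "p \<noteq> 0" "p \<in> P"
      using neg by blast
    then obtain q n where q: "\<And>k. q k \<in> vars_in Y" "q n \<noteq> 0" "p = (\<Sum>k\<le>n. q k * Var e ^ k)"
      using expand_in_variable[OF p(1,2)] by blast
    have "Var e ^ k \<in> frac_span (vars_in Y) P ((^) (Var e) ` {..<n})" for k
      using q(1,2) p(3)[unfolded q(3)] by (rule power_in_frac_span)
    then show ?thesis
      by (intro exI[of _ "(^) (Var e) ` {..<n}"]) auto
  qed
  \<comment> \<open>Adjoining one variable at a time: the products of two finite spanning sets span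
    the products of the monomials.\<close>
  have "\<exists>B. finite B \<and> (\<forall>a. keys a \<subseteq> Z \<longrightarrow> single a 1 \<in> frac_span (vars_in Y) P B)" if "finite Z" for Z
    using that
  proof (induction Z rule: finite_induct)
    case empty
    have "(1 :: ('e, 'k) mpol) \<in> frac_span (vars_in Y) P {1}"
      by (intro frac_span_base) auto
    then show ?case
      by (intro exI[of _ "{1}"]) auto
  next
    case (insert e Z)
    then obtain B where B: "finite B" "\<And>a. keys a \<subseteq> Z \<Longrightarrow> single a 1 \<in> frac_span (vars_in Y) P B"
      by blast
    obtain C where C: "finite C" "\<And>k. Var e ^ k \<in> frac_span (vars_in Y) P C"
      using powers by blast
    have "single a 1 \<in> frac_span (vars_in Y) P ((\<lambda>(b, c). b * c) ` (B \<times> C))" if "keys a \<subseteq> insert e Z" for a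
    proof -
      let ?b = "a - single e (lookup a e)"
      have "\<And>x. lookup a x \<noteq> 0 \<Longrightarrow> e \<noteq> x \<Longrightarrow> x \<in> Z"
        using that by (auto simp: in_keys_iff subset_iff)
      then have "keys ?b \<subseteq> Z"
        by (auto simp: in_keys_iff lookup_minus lookup_single when_def split: if_splits)
      then have "single ?b 1 * Var e ^ lookup a e \<in> frac_span (vars_in Y) P ((\<lambda>(b, c). b * c) ` (B \<times> C))"
        using B C by (intro frac_span_mult) auto
      moreover have "?b + single e (lookup a e) = a"
        by (intro poly_mapping_eqI) (auto simp: lookup_add lookup_minus lookup_single when_def)
      ultimately show ?thesis
        by (simp add: single_mult_Var_power)
    qed
    then show ?case
      using B(1) C(1) by (intro exI[of _ "(\<lambda>(b, c). b * c) ` (B \<times> C)"]) auto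
  qed
  from this[of UNIV] obtain B where
    B: "finite B" "\<And>a. single a 1 \<in> frac_span (vars_in Y) P B"
    by auto
  have "p \<in> frac_span (vars_in Y) P B" for p
  proof -
    have "single 0 (lookup p a) * single a 1 \<in> frac_span (vars_in Y) P B" for a
      using B(2) by (rule frac_span_scale) (simp add: vars_in_def)
    then have "(\<Sum>a\<in>keys p. single a (lookup p a)) \<in> frac_span (vars_in Y) P B"
      by (intro frac_span_sum) (simp add: mult_single)
    then show ?thesis
      by (simp add: sum_single_lookup)
  qed
  then have "Q \<subseteq> P"
    using frac_span_UNIV_imp_subset[OF B(1) _ Q] \<open>P \<subset> Q\<close> Y by blast
  then show False
    using \<open>P \<subset> Q\<close> by blast
qed

text \<open>Descending the chain from \<open>c n\<close>, every strict inclusion enlarges the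
  independent set of variables by one.\<close>

lemma prime_chain_length_le:
  fixes c :: "nat \<Rightarrow> ('e::finite, 'k::comm_ring_1) mpol set"
  assumes "\<And>i. i \<le> n \<Longrightarrow> prime_ideal (c i)" and "\<And>i. i < n \<Longrightarrow> c i \<subset> c (Suc i)"
    and "vars_in Y \<inter> c n \<subseteq> {0}"
  shows "card Y + n \<le> card (UNIV :: 'e set)"
  using assms
proof (induction n arbitrary: Y)
  case 0
  then show ?case
    by (simp add: card_mono)
next
  case (Suc n)
  obtain e where e: "e \<notin> Y" "vars_in (insert e Y) \<inter> c n \<subseteq> {0}"
    using indep_vars_extend[of "c n" "c (Suc n)" Y] Suc.prems by (auto simp: prime_ideal_def)
  have "card (insert e Y) + n \<le> card (UNIV :: 'e set)"
    using Suc.prems e(2) by (intro Suc.IH) auto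
  then show ?case
    using e(1) by simp
qed

lemma height_prime_le:
  fixes P :: "('e::finite, 'k::comm_ring_1) mpol set"
  assumes "prime_ideal P" and Y: "vars_in Y \<inter> P \<subseteq> {0}"
  shows "height P \<le> enat (card (UNIV :: 'e set) - card Y)"
proof -
  have "height P \<le> prime_height P"
    unfolding height_def by (rule Inf_lower) (use assms(1) in auto)
  also have "prime_height P \<le> enat (card (UNIV :: 'e set) - card Y)"
    unfolding prime_height_def
  proof (rule Sup_least)
    fix h assume "h \<in> {enat n |n. \<exists>c. (\<forall>i\<le>n. prime_ideal (c i)) \<and> (\<forall>i<n. c i \<subset> c (Suc i)) \<and> c n = P}"
    then obtain n and c :: "nat \<Rightarrow> ('e, 'k) mpol set" where "h = enat n" "\<And>i. i \<le> n \<Longrightarrow> prime_ideal (c i)"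
        "\<And>i. i < n \<Longrightarrow> c i \<subset> c (Suc i)" "c n = P"
      by auto
    then show "h \<le> enat (card (UNIV :: 'e set) - card Y)"
      using prime_chain_length_le[of n c Y] Y by simp
  qed
  finally show ?thesis .
qed

section \<open>Homogeneous ideals\<close>

text \<open>Homogeneous components commute with multiplication by a single term up to a shift of
  degree, so closure under terms is what can be checked directly.\<close>

lemma is_ideal_if_single_mult:
  fixes J :: "('x, 'k::comm_ring_1) mpol set"
  assumes "0 \<in> J" and "\<And>p q. p \<in> J \<Longrightarrow> q \<in> J \<Longrightarrow> p + q \<in> J"
    and "\<And>a c p. p \<in> J \<Longrightarrow> single a c * p \<in> J"
  shows "is_ideal J"
proof -
  have "r * p \<in> J" if "p \<in> J" for r p
    using that assms by (induction r rule: poly_mapping_induct_single) (auto simp: distrib_right)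
  then show ?thesis
    using assms by (auto simp: is_ideal_def)
qed

definition tdeg :: "('x::finite \<Rightarrow>\<^sub>0 nat) \<Rightarrow> nat" where
  "tdeg a = (\<Sum>e\<in>UNIV. lookup a e)"

lemma tdeg_add: "tdeg (a + b) = tdeg a + tdeg b"
  by (simp add: tdeg_def lookup_add sum.distrib)

lemma tdeg_eq_0_iff: "tdeg a = 0 \<longleftrightarrow> a = 0"
  by (auto simp: tdeg_def intro: poly_mapping_eqI)

definition hcomp :: "nat \<Rightarrow> ('x::finite, 'k::comm_ring_1) mpol \<Rightarrow> ('x, 'k) mpol" where
  "hcomp k p = (\<Sum>a\<in>{a \<in> keys p. tdeg a = k}. single a (lookup p a))"

lemma lookup_hcomp: "lookup (hcomp k p) a = (if tdeg a = k then lookup p a else 0)"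
  by (auto simp: hcomp_def lookup_sum lookup_single when_def in_keys_iff)

lemma hcomp_zero [simp]: "hcomp k 0 = 0"
  by (simp add: hcomp_def)

lemma hcomp_add: "hcomp k (p + q) = hcomp k p + hcomp k q"
  by (rule poly_mapping_eqI) (simp add: lookup_hcomp lookup_add)

lemma hcomp_single: "hcomp k (single a c) = (if tdeg a = k then single a c else 0)"
  by (rule poly_mapping_eqI) (auto simp: lookup_hcomp lookup_single when_def)

lemma hcomp_single_mult:
  "hcomp k (single b c * p) = (if tdeg b \<le> k then single b c * hcomp (k - tdeg b) p else 0)"
  by (induction p rule: poly_mapping_induct_single)
     (auto simp: mult_single hcomp_single hcomp_add tdeg_add distrib_left)

definition homogeneous :: "nat \<Rightarrow> ('x::finite, 'k::comm_ring_1) mpol \<Rightarrow> bool" where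
  "homogeneous d p \<longleftrightarrow> (\<forall>a\<in>keys p. tdeg a = d)"

lemma hcomp_homogeneous: "homogeneous d p \<Longrightarrow> hcomp k p = (if k = d then p else 0)"
  by (rule poly_mapping_eqI) (auto simp: lookup_hcomp homogeneous_def in_keys_iff)

lemma hcomp_in_ideal_gen:
  assumes hom: "\<And>g. g \<in> S \<Longrightarrow> \<exists>d. homogeneous d g" and "p \<in> ideal_gen S"
  shows "hcomp k p \<in> ideal_gen S"
proof -
  let ?J = "{p. \<forall>k. hcomp k p \<in> ideal_gen S}"
  note [intro] = is_ideal_zero[OF is_ideal_ideal_gen] is_ideal_add[OF is_ideal_ideal_gen]
    is_ideal_mult[OF is_ideal_ideal_gen]
  have "is_ideal ?J"
    by (rule is_ideal_if_single_mult) (auto simp: hcomp_add hcomp_single_mult)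
  moreover have "S \<subseteq> ?J"
  proof
    fix g assume "g \<in> S"
    then obtain d where "homogeneous d g"
      using hom by blast
    then show "g \<in> ?J"
      using \<open>g \<in> S\<close> subset_ideal_gen[of S] by (auto simp: hcomp_homogeneous)
  qed
  ultimately show ?thesis
    using assms(2) ideal_gen_least[of ?J S] by blast
qed

text \<open>A multiple of \<open>f\<close> has no component below degree \<open>d\<close>, so there
  only the other generators contribute.\<close>

lemma hcomp_below_in_ideal_gen:
  assumes hom: "\<And>g. g \<in> S \<Longrightarrow> \<exists>d. homogeneous d g" and f: "homogeneous d f"
    and "p \<in> ideal_gen S" and "k < d"
  shows "hcomp k p \<in> ideal_gen (S - {f})"
proof -
  let ?N = "ideal_gen (S - {f})"
  let ?J = "{p. \<forall>k<d. hcomp k p \<in> ?N}"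
  note [intro] = is_ideal_zero[OF is_ideal_ideal_gen] is_ideal_add[OF is_ideal_ideal_gen]
    is_ideal_mult[OF is_ideal_ideal_gen]
  have "is_ideal ?J"
    by (rule is_ideal_if_single_mult) (auto simp: hcomp_add hcomp_single_mult)
  moreover have "S \<subseteq> ?J"
  proof
    fix g assume "g \<in> S"
    show "g \<in> ?J"
    proof (cases "g = f")
      case True
      then show ?thesis
        using f by (auto simp: hcomp_homogeneous)
    next
      case False
      then have "g \<in> ?N"
        using \<open>g \<in> S\<close> subset_ideal_gen[of "S - {f}"] by auto
      then show ?thesis
        using hcomp_in_ideal_gen[of "S - {f}" g] hom by auto
    qed
  qed
  ultimately show ?thesis
    using assms(3,4) ideal_gen_least[of ?J S] by blast
qed

text \<open>Every nonconstant term of \<open>q\<close> pushes \<open>g\<close> beyond degree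
  \<open>d\<close>.\<close>

lemma hcomp_mult_homogeneous:
  assumes "homogeneous d g"
  shows "hcomp d (q * g) = single 0 (lookup q 0) * g"
proof (induction q rule: poly_mapping_induct_single)
  case zero
  then show ?case by simp
next
  case (single b c)
  show ?case
  proof (cases "b = 0")
    case True
    then show ?thesis
      using assms by (simp add: hcomp_single_mult tdeg_eq_0_iff hcomp_homogeneous tdeg_def)
  next
    case False
    then have "tdeg b \<noteq> 0"
      by (simp add: tdeg_eq_0_iff)
    then show ?thesis
      using assms False by (auto simp: hcomp_single_mult hcomp_homogeneous lookup_single)
  qed
next
  case (add f g)
  then show ?case
    by (simp add: distrib_right hcomp_add lookup_add single_add)
qed

lemma lookup_mult_0:
  fixes p q :: "('x, 'k::comm_ring_1) mpol"
  shows "lookup (p * q) 0 = lookup p 0 * lookup q 0"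
proof (induction p rule: poly_mapping_induct_single)
  case (single a c)
  show ?case
  proof (induction q rule: poly_mapping_induct_single)
    case (single b d)
    have "a + b = 0 \<longleftrightarrow> a = 0 \<and> b = 0"
      by (auto simp: poly_mapping_eq_iff lookup_add fun_eq_iff)
    then show ?case
      by (auto simp: mult_single lookup_single when_def)
  qed (auto simp: distrib_left lookup_add)
qed (auto simp: distrib_right lookup_add)

text \<open>Graded Nakayama: a linear dependence modulo the irrelevant ideal times the ideal makes one of
  the homogeneous generators redundant.\<close>

lemma minimal_homogeneous_generators_card_le:
  fixes S T :: "('x::finite, 'k::field) mpol set"
  assumes "finite S" and gen: "ideal_gen S = ideal_gen T"
    and hom: "\<And>g. g \<in> T \<Longrightarrow> \<exists>d. homogeneous d g"
    and min: "\<And>g. g \<in> T \<Longrightarrow> g \<notin> ideal_gen (T - {g})"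
  shows "finite T \<and> card T \<le> card S"
proof (rule ccontr)
  assume "\<not> ?thesis"
  \<comment> \<open>Passing to a finite \<open>F\<close> treats an infinite \<open>T\<close> and a
    finite but too large \<open>T\<close> together.\<close>
  then have "\<exists>F\<subseteq>T. finite F \<and> card F = Suc (card S)"
    by (metis infinite_arbitrarily_large not_less_eq_eq obtain_subset_with_card_n)
  then obtain F where F: "F \<subseteq> T" "finite F" "card F = Suc (card S)"
    by blast
  have "\<exists>p. g = (\<Sum>s\<in>S. p s * s)" if "g \<in> F" for g
  proof -
    have "g \<in> ideal_gen S"
      using that F(1) subset_ideal_gen[of T] gen by auto
    then show ?thesis
      using ideal_gen_finite_combination[OF \<open>finite S\<close>] by blast
  qed
  then obtain p where p: "\<And>g. g \<in> F \<Longrightarrow> g = (\<Sum>s\<in>S. p g s * s)"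
    by metis
  \<comment> \<open>There is one equation for each element of \<open>S\<close> and one more unknown.
    The solution kills the constant terms of all coefficients in the combined expression.\<close>
  have "\<exists>c. (\<forall>g\<in>F. c g \<in> (UNIV :: 'k set)) \<and> (\<exists>g\<in>F. c g \<noteq> 0) \<and>
      (\<forall>s\<in>S. (\<Sum>g\<in>F. c g * lookup (p g s) 0) = 0)"
    using \<open>finite S\<close> F by (intro homogeneous_system_nontrivial_solution) (auto simp: subring_def)
  then obtain c f where c: "\<And>s. s \<in> S \<Longrightarrow> (\<Sum>g\<in>F. c g * lookup (p g s) 0) = 0"
      and f: "f \<in> F" "c f \<noteq> 0"
    by blast
  define N where "N = ideal_gen (T - {f})"
  have N: "is_ideal N"
    by (simp add: N_def is_ideal_ideal_gen)
  have "\<exists>n q. n \<in> N \<and> s = n + q * f" if "s \<in> S" for s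
  proof -
    let ?J = "{x. \<exists>n q. n \<in> N \<and> x = n + q * f}"
    have "is_ideal ?J"
      unfolding is_ideal_def
    proof (intro conjI ballI allI)
      show "0 \<in> ?J"
        using is_ideal_zero[OF N] by (auto intro!: exI[of _ 0])
    next
      fix x y assume "x \<in> ?J" and "y \<in> ?J"
      then obtain n q n' q' where *: "n \<in> N" "x = n + q * f" "n' \<in> N" "y = n' + q' * f"
        by auto
      then have "x + y = (n + n') + (q + q') * f"
        by (simp add: algebra_simps)
      then show "x + y \<in> ?J"
        using is_ideal_add[OF N] * by blast
    next
      fix r x assume "x \<in> ?J"
      then obtain n q where *: "n \<in> N" "x = n + q * f"
        by auto
      then have "r * x = r * n + (r * q) * f"
        by (simp add: algebra_simps)
      then show "r * x \<in> ?J"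
        using is_ideal_mult[OF N] * by blast
    qed
    moreover have "T \<subseteq> ?J"
    proof
      fix t assume "t \<in> T"
      have "0 + 1 * f \<in> ?J"
        using is_ideal_zero[OF N] by blast
      moreover have "t + 0 * f \<in> ?J" if "t \<noteq> f"
        using \<open>t \<in> T\<close> that subset_ideal_gen[of "T - {f}"] unfolding N_def by blast
      ultimately show "t \<in> ?J"
        by (cases "t = f") simp_all
    qed
    ultimately have "ideal_gen T \<subseteq> ?J"
      by (rule ideal_gen_least)
    then show ?thesis
      using that gen subset_ideal_gen[of S] by auto
  qed
  then obtain n q where nq: "\<And>s. s \<in> S \<Longrightarrow> n s \<in> N" "\<And>s. s \<in> S \<Longrightarrow> s = n s + q s * f"
    by metis
  \<comment> \<open>After substituting \<open>s = n s + q s * f\<close>, the multiplier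
    \<open>r\<close> of \<open>f\<close> has no constant term, while the left side contains
    \<open>f\<close> with the unit \<open>c f\<close>. Taking the component in the degree of
    \<open>f\<close> therefore removes \<open>r\<close>.\<close>
  define h where "h s = (\<Sum>g\<in>F. single 0 (c g) * p g s)" for s
  define r where "r = (\<Sum>s\<in>S. h s * q s)"
  have h0: "lookup (h s) 0 = 0" if "s \<in> S" for s
    using c[OF that] by (simp add: h_def lookup_sum lookup_mult_0)
  have r0: "lookup r 0 = 0"
    by (simp add: r_def lookup_sum lookup_mult_0 h0)
  have "(\<Sum>g\<in>F. single 0 (c g) * g) = (\<Sum>g\<in>F. \<Sum>s\<in>S. single 0 (c g) * p g s * s)"
    by (rule sum.cong[OF refl], subst p) (simp_all add: sum_distrib_left mult.assoc)
  also have "\<dots> = (\<Sum>s\<in>S. h s * s)"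
    by (subst sum.swap) (simp add: h_def sum_distrib_right)
  also have "\<dots> = (\<Sum>s\<in>S. h s * n s + h s * q s * f)"
    by (rule sum.cong[OF refl], subst nq(2)) (simp_all add: algebra_simps)
  also have "\<dots> = (\<Sum>s\<in>S. h s * n s) + r * f"
    by (simp add: r_def sum.distrib sum_distrib_right)
  finally have "single 0 (c f) * f + (\<Sum>g\<in>F - {f}. single 0 (c g) * g) = (\<Sum>s\<in>S. h s * n s) + r * f"
    using F(2) f(1) by (simp add: sum.remove)
  then have eq: "(single 0 (c f) - r) * f = (\<Sum>s\<in>S. h s * n s) - (\<Sum>g\<in>F - {f}. single 0 (c g) * g)"
    by (simp add: algebra_simps)
  have "(single 0 (c f) - r) * f \<in> N"
    unfolding eq
  proof (rule is_ideal_diff[OF N])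
    show "(\<Sum>s\<in>S. h s * n s) \<in> N"
      using nq(1) by (intro is_ideal_sum[OF N] is_ideal_mult[OF N]) auto
    show "(\<Sum>g\<in>F - {f}. single 0 (c g) * g) \<in> N"
      using F(1) subset_ideal_gen[of "T - {f}"] unfolding N_def[symmetric]
      by (intro is_ideal_sum[OF N] is_ideal_mult[OF N]) auto
  qed
  moreover obtain d where d: "homogeneous d f"
    using hom f F(1) by blast
  ultimately have "hcomp d ((single 0 (c f) - r) * f) \<in> N"
    unfolding N_def using hom by (intro hcomp_in_ideal_gen) auto
  then have "single 0 (c f) * f \<in> N"
    by (simp add: hcomp_mult_homogeneous[OF d] lookup_minus r0)
  then have "single 0 (inverse (c f)) * (single 0 (c f) * f) \<in> N"
    by (rule is_ideal_mult[OF N])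
  then have "f \<in> N"
    using f(2) by (simp add: mult_single flip: mult.assoc)
  then show False
    using min f(1) F(1) by (auto simp: N_def)
qed

section \<open>The toric ideal\<close>

text \<open>\<open>toric_map\<close> for an arbitrary map of exponents, so that the vertices can be
  renamed when the toric ideal is shown to be prime.\<close>

definition pushforward :: "('a \<Rightarrow> 'b) \<Rightarrow> ('a \<Rightarrow>\<^sub>0 'k::comm_monoid_add) \<Rightarrow> ('b \<Rightarrow>\<^sub>0 'k)" where
  "pushforward \<phi> f = (\<Sum>a\<in>keys f. single (\<phi> a) (lookup f a))"

lemma toric_map_eq_pushforward: "toric_map ends = pushforward (toric_exp ends)"
  by (simp add: fun_eq_iff toric_map_def pushforward_def)

lemma pushforward_superset:
  "finite A \<Longrightarrow> keys f \<subseteq> A \<Longrightarrow> pushforward \<phi> f = (\<Sum>a\<in>A. single (\<phi> a) (lookup f a))"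
  unfolding pushforward_def by (rule sum.mono_neutral_left) (auto simp: in_keys_iff)

lemma pushforward_zero [simp]: "pushforward \<phi> 0 = 0"
  by (simp add: pushforward_def)

lemma pushforward_single [simp]: "pushforward \<phi> (single a c) = single (\<phi> a) c"
  by (simp add: pushforward_def)

lemma pushforward_add: "pushforward \<phi> (f + g) = pushforward \<phi> f + pushforward \<phi> g"
proof -
  let ?A = "keys f \<union> keys g"
  have "pushforward \<phi> (f + g) = (\<Sum>a\<in>?A. single (\<phi> a) (lookup (f + g) a))"
    using keys_add[of f g] by (intro pushforward_superset) auto
  also have "\<dots> = (\<Sum>a\<in>?A. single (\<phi> a) (lookup f a)) + (\<Sum>a\<in>?A. single (\<phi> a) (lookup g a))"
    by (simp add: lookup_add single_add sum.distrib)
  also have "\<dots> = pushforward \<phi> f + pushforward \<phi> g"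
    using pushforward_superset[of ?A f \<phi>] pushforward_superset[of ?A g \<phi>] by simp
  finally show ?thesis .
qed

lemma pushforward_mult:
  fixes f g :: "'a::comm_monoid_add \<Rightarrow>\<^sub>0 'k::comm_ring_1" and \<phi> :: "'a \<Rightarrow> 'b::comm_monoid_add"
  assumes "\<And>a b. \<phi> (a + b) = \<phi> a + \<phi> b"
  shows "pushforward \<phi> (f * g) = pushforward \<phi> f * pushforward \<phi> g"
proof (induction f rule: poly_mapping_induct_single)
  case (single a c)
  show ?case
    by (induction g rule: poly_mapping_induct_single)
       (auto simp: mult_single assms pushforward_add distrib_left)
qed (auto simp: pushforward_add distrib_right)

text \<open>The kernel depends only on the partition into fibers of \<open>\<phi>\<close>. Maps with
  the same fibers thus define the same ideal.\<close>

lemma pushforward_eq_0_iff: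
  "pushforward \<phi> f = 0 \<longleftrightarrow> (\<forall>b. (\<Sum>a\<in>{a \<in> keys f. \<phi> a = \<phi> b}. lookup f a) = 0)"
proof -
  have lookup: "lookup (pushforward \<phi> f) d = (\<Sum>a\<in>{a \<in> keys f. \<phi> a = d}. lookup f a)" for d
    by (simp add: pushforward_def lookup_sum lookup_single when_def sum.inter_filter)
  have "(\<Sum>a\<in>{a \<in> keys f. \<phi> a = d}. lookup f a) = 0" if "d \<notin> range \<phi>" for d
    using that by (intro sum.neutral) auto
  then show ?thesis
    unfolding poly_mapping_eq_iff fun_eq_iff lookup by (auto simp: image_iff) metis
qed

lemma lookup_toric_exp: "lookup (toric_exp ends a) v = (\<Sum>e | v \<in> ends e. lookup a e)"
  by (simp add: toric_exp_def)

lemma toric_exp_add: "toric_exp ends (a + b) = toric_exp ends a + toric_exp ends b"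
  by (rule poly_mapping_eqI) (simp add: lookup_toric_exp lookup_add sum.distrib)

lemma toric_exp_zero: "toric_exp ends 0 = 0"
  by (rule poly_mapping_eqI) (simp add: lookup_toric_exp)

lemma prime_ideal_toric_ideal: "prime_ideal (toric_ideal ends :: ('e::finite, 'k::field) mpol set)"
  for ends :: "'e::finite \<Rightarrow> 'v::finite set"
proof -
  obtain g :: "'v \<Rightarrow> nat" where g: "inj g"
    using finite_imp_inj_to_nat_seg[of "UNIV :: 'v set"] by auto
  \<comment> \<open>Renaming vertices to numbers makes the monomials linearly ordered, hence the target a domain.\<close>
  define \<psi> where "\<psi> a = (\<Sum>v\<in>UNIV. single (g v) (lookup (toric_exp ends a) v))" for a
  have \<psi>_add: "\<psi> (a + b) = \<psi> a + \<psi> b" for a b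
    by (simp add: \<psi>_def toric_exp_add lookup_add single_add sum.distrib)
  have "lookup (\<psi> a) (g v) = lookup (toric_exp ends a) v" for a v
    by (simp add: \<psi>_def lookup_sum lookup_single when_def inj_eq[OF g])
  then have "\<psi> a = \<psi> b \<longleftrightarrow> toric_exp ends a = toric_exp ends b" for a b
    unfolding \<psi>_def by (metis poly_mapping_eqI)
  then have mem: "f \<in> toric_ideal ends \<longleftrightarrow> pushforward \<psi> f = 0" for f :: "('e, 'k) mpol"
    by (simp add: toric_ideal_def toric_map_eq_pushforward pushforward_eq_0_iff)
  have "pushforward \<psi> 1 = (1 :: (nat \<Rightarrow>\<^sub>0 nat) \<Rightarrow>\<^sub>0 'k)"
    by (simp add: \<psi>_def toric_exp_zero flip: single_one)
  then have "1 \<notin> (toric_ideal ends :: ('e, 'k) mpol set)"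
    by (simp add: mem)
  then show ?thesis
    unfolding prime_ideal_def is_ideal_def
    by (auto simp: mem pushforward_add pushforward_mult[OF \<psi>_add])
qed

lemma binomial_in_toric_ideal_iff:
  "monom u - monom v \<in> (toric_ideal ends :: ('e::finite, 'k::field) mpol set) \<longleftrightarrow> toric_exp ends u = toric_exp ends v"
proof -
  have "monom u - monom v = single u 1 + single v (- 1 :: 'k)"
    by (simp add: monom_def single_uminus)
  then have "toric_map ends (monom u - monom v) = (single (toric_exp ends u) 1 + single (toric_exp ends v) (- 1) :: (_, 'k) mpol)"
    by (simp add: toric_map_eq_pushforward pushforward_add)
  then show ?thesis
    by (auto simp: toric_ideal_def single_uminus dest: arg_cong[of _ _ "\<lambda>p. lookup p (toric_exp ends u)"]
        simp: lookup_minus lookup_single when_def split: if_splits)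
qed

text \<open>The handshake identity. It makes the toric ideal homogeneous for the standard
  grading.\<close>

lemma sum_toric_exp:
  fixes ends :: "'e::finite \<Rightarrow> 'v::finite set"
  assumes "simple_graph ends"
  shows "(\<Sum>v\<in>UNIV. lookup (toric_exp ends a) v) = 2 * tdeg a"
proof -
  have "(\<Sum>v\<in>UNIV. lookup (toric_exp ends a) v) = (\<Sum>v\<in>UNIV. \<Sum>e\<in>{e \<in> UNIV. v \<in> ends e}. lookup a e)"
    by (simp add: lookup_toric_exp)
  also have "\<dots> = (\<Sum>e\<in>UNIV. \<Sum>v\<in>{v \<in> UNIV. v \<in> ends e}. lookup a e)"
    by (rule sum.swap_restrict) auto
  also have "\<dots> = 2 * tdeg a"
    using assms by (simp add: simple_graph_def tdeg_def sum_distrib_left)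
  finally show ?thesis .
qed

lemma toric_exp_eq_imp_tdeg_eq:
  "simple_graph ends \<Longrightarrow> toric_exp ends u = toric_exp ends v \<Longrightarrow> tdeg u = tdeg v"
  using sum_toric_exp[of ends u] sum_toric_exp[of ends v] by simp

lemma homogeneous_binomial: "tdeg u = d \<Longrightarrow> tdeg v = d \<Longrightarrow> homogeneous d (monom u - monom v)"
  using keys_diff[of "monom u" "monom v"] by (auto simp: homogeneous_def monom_def)

section \<open>Congruences\<close>

text \<open>The linear functional on polynomials that takes the value \<open>\<phi> a\<close> on the
  monomial with exponent \<open>a\<close>.\<close>

definition pairing :: "('a \<Rightarrow>\<^sub>0 'k::comm_ring_1) \<Rightarrow> ('a \<Rightarrow> 'k) \<Rightarrow> 'k" where
  "pairing p \<phi> = (\<Sum>a\<in>keys p. lookup p a * \<phi> a)"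

lemma pairing_superset:
  "finite A \<Longrightarrow> keys p \<subseteq> A \<Longrightarrow> pairing p \<phi> = (\<Sum>a\<in>A. lookup p a * \<phi> a)"
  unfolding pairing_def by (rule sum.mono_neutral_left) (auto simp: in_keys_iff)

lemma pairing_zero [simp]: "pairing 0 \<phi> = 0"
  by (simp add: pairing_def)

lemma pairing_single [simp]: "pairing (single a c) \<phi> = c * \<phi> a"
  by (simp add: pairing_def)

lemma pairing_add: "pairing (p + q) \<phi> = pairing p \<phi> + pairing q \<phi>"
proof -
  let ?A = "keys p \<union> keys q"
  have "pairing (p + q) \<phi> = (\<Sum>a\<in>?A. lookup (p + q) a * \<phi> a)"
    using keys_add[of p q] by (intro pairing_superset) auto
  also have "\<dots> = (\<Sum>a\<in>?A. lookup p a * \<phi> a) + (\<Sum>a\<in>?A. lookup q a * \<phi> a)"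
    by (simp add: lookup_add distrib_right sum.distrib)
  also have "\<dots> = pairing p \<phi> + pairing q \<phi>"
    using pairing_superset[of ?A p \<phi>] pairing_superset[of ?A q \<phi>] by simp
  finally show ?thesis .
qed

lemma pairing_single_mult:
  fixes p :: "'a::comm_monoid_add \<Rightarrow>\<^sub>0 'k::comm_ring_1"
  shows "pairing (single b c * p) \<phi> = c * pairing p (\<lambda>a. \<phi> (a + b))"
  by (induction p rule: poly_mapping_induct_single)
     (auto simp: mult_single pairing_add distrib_left add.commute mult.assoc)

lemma pairing_binomial: "pairing (monom u - monom v) \<phi> = \<phi> u - \<phi> v"
  using pairing_add[of "monom u - monom v" "monom v" \<phi>] by (simp add: monom_def algebra_simps)

text \<open>Functionals that are constant on the classes of \<open>rel\<close> and stay so under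
  translation vanish on the whole ideal. The indicator of the class of \<open>u\<close> then
  separates \<open>u\<close> from every unrelated exponent.\<close>

lemma binomial_ideal_congruence:
  fixes S :: "('x, 'k::field) mpol set"
  assumes sym: "\<And>a b. rel a b \<Longrightarrow> rel b a" and trans: "\<And>a b c. rel a b \<Longrightarrow> rel b c \<Longrightarrow> rel a c"
    and refl: "\<And>a. rel a a" and add: "\<And>a b c. rel a b \<Longrightarrow> rel (a + c) (b + c)"
    and gens: "\<And>g. g \<in> S \<Longrightarrow> \<exists>u v. g = monom u - monom v \<and> rel u v"
    and mem: "monom u - monom v \<in> ideal_gen S"
  shows "rel u v"
proof -
  define inv where "inv \<phi> \<longleftrightarrow> (\<forall>a b. rel a b \<longrightarrow> \<phi> a = \<phi> b)" for \<phi> :: "_ \<Rightarrow> 'k"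
  let ?J = "{p. \<forall>\<phi>. inv \<phi> \<longrightarrow> pairing p \<phi> = 0}"
  have "inv (\<lambda>a. \<phi> (a + c))" if "inv \<phi>" for \<phi> c
    using that add by (auto simp: inv_def)
  then have "is_ideal ?J"
    by (intro is_ideal_if_single_mult) (auto simp: pairing_add pairing_single_mult)
  moreover have "S \<subseteq> ?J"
    using gens by (force simp: pairing_binomial inv_def)
  ultimately have "monom u - monom v \<in> ?J"
    using mem ideal_gen_least by blast
  moreover have "inv (\<lambda>a. if rel u a then 1 else 0)"
  proof -
    have "rel u a \<longleftrightarrow> rel u b" if "rel a b" for a b
      using that sym trans by blast
    then show ?thesis
      by (simp add: inv_def)
  qed
  ultimately have "pairing (monom u - monom v) (\<lambda>a. if rel u a then 1 else 0) = (0::'k)"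
    by blast
  then have "(if rel u u then 1 else 0) - (if rel u v then 1 else 0) = (0::'k)"
    by (simp only: pairing_binomial)
  then show ?thesis
    using refl by (auto split: if_splits)
qed

section \<open>The lattice of a graph\<close>

text \<open>The unsigned incidence matrix of the graph applied to \<open>x\<close>. Its integer
  kernel is the lattice.\<close>

definition bnd :: "('e::finite \<Rightarrow> 'v set) \<Rightarrow> ('e \<Rightarrow> int) \<Rightarrow> 'v \<Rightarrow> int" where
  "bnd ends x v = (\<Sum>e | v \<in> ends e. x e)"

lemma bnd_zero [simp]: "bnd ends (\<lambda>_. 0) v = 0"
  by (simp add: bnd_def)

lemma bnd_diff: "bnd ends (\<lambda>e. x e - y e) v = bnd ends x v - bnd ends y v"
  by (simp add: bnd_def sum_subtractf)

lemma bnd_scale: "bnd ends (\<lambda>e. c * x e) v = c * bnd ends x v"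
  by (simp add: bnd_def sum_distrib_left)

lemma bnd_sum: "bnd ends (\<lambda>e. \<Sum>i\<in>I. x i e) v = (\<Sum>i\<in>I. bnd ends (x i) v)"
  unfolding bnd_def by (rule sum.swap)

lemma bnd_indicator: "bnd ends (\<lambda>e. if e = d then 1 else 0) v = (if v \<in> ends d then 1 else 0)"
  by (simp add: bnd_def sum.delta)

lemma bnd_lookup: "bnd ends (\<lambda>e. int (lookup u e)) v = int (lookup (toric_exp ends u) v)"
  by (simp add: bnd_def lookup_toric_exp)

definition int_comb :: "'i set \<Rightarrow> ('i \<Rightarrow> 'e \<Rightarrow> int) \<Rightarrow> ('e \<Rightarrow> int) set" where
  "int_comb F b = {x. \<exists>c. \<forall>e. x e = (\<Sum>g\<in>F. c g * b g e)}"

definition int_submodule :: "('e \<Rightarrow> int) set \<Rightarrow> bool" where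
  "int_submodule U \<longleftrightarrow> (\<lambda>_. 0) \<in> U \<and> (\<forall>x\<in>U. \<forall>y\<in>U. (\<lambda>e. x e + y e) \<in> U) \<and> (\<forall>c. \<forall>x\<in>U. (\<lambda>e. c * x e) \<in> U)"

lemma int_submodule_zero: "int_submodule U \<Longrightarrow> (\<lambda>_. 0) \<in> U"
  and int_submodule_add: "int_submodule U \<Longrightarrow> x \<in> U \<Longrightarrow> y \<in> U \<Longrightarrow> (\<lambda>e. x e + y e) \<in> U"
  and int_submodule_scale: "int_submodule U \<Longrightarrow> x \<in> U \<Longrightarrow> (\<lambda>e. c * x e) \<in> U"
  by (auto simp: int_submodule_def)

lemma int_submodule_sum:
  "int_submodule U \<Longrightarrow> (\<And>i. i \<in> I \<Longrightarrow> x i \<in> U) \<Longrightarrow> (\<lambda>e. \<Sum>i\<in>I. x i e) \<in> U"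
  by (induction I rule: infinite_finite_induct) (auto intro: int_submodule_zero int_submodule_add)

lemma int_submodule_int_comb: "int_submodule (int_comb F b)"
  unfolding int_submodule_def
proof (intro conjI ballI allI)
  show "(\<lambda>_. 0) \<in> int_comb F b"
    by (auto simp: int_comb_def intro: exI[of _ "\<lambda>_. 0"])
next
  fix x y assume "x \<in> int_comb F b" and "y \<in> int_comb F b"
  then obtain c d where "\<And>e. x e = (\<Sum>g\<in>F. c g * b g e)" "\<And>e. y e = (\<Sum>g\<in>F. d g * b g e)"
    by (auto simp: int_comb_def)
  then have "\<forall>e. x e + y e = (\<Sum>g\<in>F. (c g + d g) * b g e)"
    by (simp add: distrib_right sum.distrib)
  then show "(\<lambda>e. x e + y e) \<in> int_comb F b"
    unfolding int_comb_def mem_Collect_eq by (rule exI[of _ "\<lambda>g. c g + d g"])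
next
  fix k x assume "x \<in> int_comb F b"
  then obtain c where "\<And>e. x e = (\<Sum>g\<in>F. c g * b g e)"
    by (auto simp: int_comb_def)
  then have "\<forall>e. k * x e = (\<Sum>g\<in>F. (k * c g) * b g e)"
    by (simp add: sum_distrib_left mult.assoc)
  then show "(\<lambda>e. k * x e) \<in> int_comb F b"
    unfolding int_comb_def mem_Collect_eq by (rule exI[of _ "\<lambda>g. k * c g"])
qed

lemma int_comb_base:
  assumes "finite F" and "g \<in> F"
  shows "b g \<in> int_comb F b"
proof -
  have "\<forall>e. b g e = (\<Sum>h\<in>F. (if h = g then 1 else 0) * b h e)"
    using assms by (simp add: if_distrib[of "\<lambda>c. c * _"] cong: if_cong)
  then show ?thesis
    unfolding int_comb_def mem_Collect_eq by (rule exI[of _ "\<lambda>h. if h = g then 1 else 0"])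
qed

text \<open>Moves through a fiber of degree at most one at \<open>a\<close> cannot involve \<open>f\<close>.\<close>

lemma low_degree_in_span:
  fixes S :: "('e::finite, 'k::field) mpol set" and ends :: "'e \<Rightarrow> 'v::finite set"
  assumes "finite S" and gen: "ideal_gen S = toric_ideal ends"
    and pq: "\<And>g. g \<in> S \<Longrightarrow> g = monom (p g) - monom (q g)"
    and f: "2 \<le> lookup (toric_exp ends (p f)) a"
    and uv: "toric_exp ends u = toric_exp ends v" "lookup (toric_exp ends u) a \<le> 1"
  shows "(\<lambda>e. int (lookup u e) - int (lookup v e))
    \<in> int_comb (S - {f}) (\<lambda>g e. int (lookup (p g) e) - int (lookup (q g) e))" (is "_ \<in> ?U")
proof -
  \<comment> \<open>All exponents of one fiber are identified once the degree at \<open>a\<close> is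
    at least 2. This absorbs the generator \<open>f\<close>, and it survives translation because the
    degree at \<open>a\<close> can only grow.\<close>
  define rel where "rel s t \<longleftrightarrow> toric_exp ends s = toric_exp ends t \<and>
    (2 \<le> lookup (toric_exp ends s) a \<or> (\<lambda>e. int (lookup s e) - int (lookup t e)) \<in> ?U)" for s t
  note U = int_submodule_int_comb[of "S - {f}" "\<lambda>g e. int (lookup (p g) e) - int (lookup (q g) e)"]
  have "rel u v"
  proof (rule binomial_ideal_congruence[of rel S])
    fix s t assume "rel s t"
    then show "rel t s"
      using int_submodule_scale[OF U, of "\<lambda>e. int (lookup s e) - int (lookup t e)" "-1"]
      by (auto simp: rel_def)
  next
    fix r s t assume "rel r s" "rel s t"
    then show "rel r t"
      using int_submodule_add[OF U, of "\<lambda>e. int (lookup r e) - int (lookup s e)" "\<lambda>e. int (lookup s e) - int (lookup t e)"]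
      by (auto simp: rel_def)
  next
    show "rel s s" for s
      using int_submodule_zero[OF U] by (simp add: rel_def)
  next
    show "rel (s + r) (t + r)" if "rel s t" for r s t
      using that by (auto simp: rel_def toric_exp_add lookup_add)
  next
    fix g assume g: "g \<in> S"
    then have "g \<in> toric_ideal ends"
      using subset_ideal_gen[of S] gen by auto
    then have "toric_exp ends (p g) = toric_exp ends (q g)"
      using binomial_in_toric_ideal_iff pq[OF g] by metis
    then have "rel (p g) (q g)"
      using f g int_comb_base[of "S - {f}" g "\<lambda>g e. int (lookup (p g) e) - int (lookup (q g) e)"] \<open>finite S\<close>
      by (cases "g = f") (auto simp: rel_def)
    then show "\<exists>u v. g = monom u - monom v \<and> rel u v"
      using pq[OF g] by blast
  next
    show "monom u - monom v \<in> ideal_gen S"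
      using uv(1) by (simp add: gen binomial_in_toric_ideal_iff)
  qed
  then show ?thesis
    using uv(2) by (auto simp: rel_def)
qed

section \<open>Alternating walks avoiding a vertex and generation of the lattice\<close>

lemma simple_graph_other_end:
  assumes "simple_graph ends" and "v \<in> ends e"
  shows "\<exists>w. ends e = {v, w} \<and> w \<noteq> v"
proof -
  obtain x y where "ends e = {x, y}" "x \<noteq> y"
    using assms(1) unfolding simple_graph_def card_2_iff by blast
  then show ?thesis
    using assms(2) by auto
qed

text \<open>Replacing \<open>z\<close> by the new edge minus \<open>z\<close> cancels the old end of
  the walk and flips \<open>s\<close>, so \<open>s\<close> records the parity of the length.\<close>

lemma connected_imp_alternating_chain:
  fixes ends :: "'e::finite \<Rightarrow> 'v::finite set"
  assumes G: "simple_graph ends" and reach: "reach_in ends (UNIV - {a}) r c"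
  obtains z s where "s = 1 \<or> s = (- 1 :: int)" "\<And>e. a \<in> ends e \<Longrightarrow> z e = 0"
    "\<And>v. bnd ends z v = (if v = c then 1 else 0) - s * (if v = r then 1 else 0)"
proof -
  obtain p where p: "p \<noteq> []" "hd p = r" "last p = c" "a \<notin> set p"
      "\<And>i. Suc i < length p \<Longrightarrow> \<exists>e. ends e = {p ! i, p ! Suc i}"
    using reach by (auto simp: reach_in_def)
  have "\<exists>z s. (s = 1 \<or> s = (- 1 :: int)) \<and> (\<forall>e. a \<in> ends e \<longrightarrow> z e = 0) \<and>
      (\<forall>v. bnd ends z v = (if v = p ! i then 1 else 0) - s * (if v = r then 1 else 0))"
    if "i < length p" for i
    using that
  proof (induction i)
    case 0
    have "p ! 0 = r"
      using p(1,2) by (simp add: hd_conv_nth)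
    then show ?case
      by (intro exI[of _ "\<lambda>_. 0"] exI[of _ 1]) simp
  next
    case (Suc i)
    then obtain z s where z: "s = 1 \<or> s = (- 1 :: int)" "\<And>e. a \<in> ends e \<Longrightarrow> z e = 0"
        "\<And>v. bnd ends z v = (if v = p ! i then 1 else 0) - s * (if v = r then 1 else 0)"
      by auto
    obtain d where d: "ends d = {p ! i, p ! Suc i}"
      using p(5) Suc.prems by blast
    then have ne: "p ! i \<noteq> p ! Suc i"
      using G by (auto simp: simple_graph_def card_2_iff dest!: spec[of _ d])
    have ad: "a \<notin> ends d"
      using d p(4) Suc.prems nth_mem[of i p] nth_mem[of "Suc i" p] by auto
    show ?case
    proof (intro exI[of _ "\<lambda>e. (if e = d then 1 else 0) - z e"] exI[of _ "- s"] conjI allI impI)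
      show "- s = 1 \<or> - s = - 1"
        using z(1) by auto
      show "(if e = d then 1 else 0) - z e = 0" if "a \<in> ends e" for e
        using that z(2) ad by auto
      show "bnd ends (\<lambda>e. (if e = d then 1 else 0) - z e) v
          = (if v = p ! Suc i then 1 else 0) - - s * (if v = r then 1 else 0)" for v
        using ne by (auto simp: bnd_diff bnd_indicator z(3) d)
    qed
  qed
  from this[of "length p - 1"] show thesis
    using p(1,3) that by (auto simp: last_conv_nth)
qed

text \<open>The sum in \<open>low\<close> is the degree at \<open>a\<close> of the positive part of
  \<open>y\<close>. The negative part has the same degree, since the boundary at \<open>a\<close>
  vanishes.\<close>

lemma lattice_spanned_by_low_degree:
  fixes ends :: "'e::finite \<Rightarrow> 'v::finite set"
  assumes G: "simple_graph ends" and conn: "connected_on ends (UNIV - {a})"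
    and U: "int_submodule U"
    and low: "\<And>y. (\<And>v. bnd ends y v = 0) \<Longrightarrow> (\<Sum>e | a \<in> ends e. max (y e) 0) \<le> 1 \<Longrightarrow> y \<in> U"
    and x: "\<And>v. bnd ends x v = 0"
  shows "x \<in> U"
proof -
  obtain r where r: "r \<noteq> a"
    using conn by (auto simp: connected_on_def)
  have "\<exists>z s. (s = 1 \<or> s = (- 1 :: int)) \<and> (\<forall>e. a \<in> ends e \<longrightarrow> z e = 0) \<and>
      (\<forall>v. bnd ends z v = (if v = c then 1 else 0) - s * (if v = r then 1 else 0))" if "c \<noteq> a" for c
  proof -
    have "reach_in ends (UNIV - {a}) r c"
      using conn that r by (auto simp: connected_on_def)
    from connected_imp_alternating_chain[OF G this] show ?thesis
      by metis
  qed
  then obtain Z' s' where Z': "\<And>c. c \<noteq> a \<Longrightarrow> s' c = 1 \<or> s' c = (- 1 :: int)"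
      "\<And>c e. c \<noteq> a \<Longrightarrow> a \<in> ends e \<Longrightarrow> Z' c e = 0"
      "\<And>c v. c \<noteq> a \<Longrightarrow> bnd ends (Z' c) v = (if v = c then 1 else 0) - s' c * (if v = r then 1 else 0)"
    by metis
  \<comment> \<open>Subtracting the chains from every edge writes \<open>x\<close> as a combination of vectors \<open>k e\<close>
    whose boundary is supported on the two vertices \<open>a\<close> and \<open>r\<close>.\<close>
  define Z where "Z c = (if c = a then (\<lambda>_. 0) else Z' c)" for c
  define s where "s c = (if c = a then 0 else s' c)" for c
  define k where "k e d = (if d = e then 1 else 0) - (\<Sum>c\<in>ends e. Z c d)" for e d
  define \<alpha> :: "'e \<Rightarrow> int" where "\<alpha> e = (if a \<in> ends e then 1 else 0)" for e
  define \<beta> where "\<beta> e = (\<Sum>c\<in>ends e. s c)" for e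
  have bnd_Z: "bnd ends (Z c) v = (if v = c \<and> c \<noteq> a then 1 else 0) - s c * (if v = r then 1 else 0)" for c v
    using Z'(3) by (auto simp: Z_def s_def)
  have bnd_k: "bnd ends (k e) v = \<alpha> e * (if v = a then 1 else 0) + \<beta> e * (if v = r then 1 else 0)" for e v
  proof -
    have "bnd ends (k e) v = (if v \<in> ends e then 1 else 0)
        - (\<Sum>c\<in>ends e. (if v = c \<and> c \<noteq> a then 1 else 0) - s c * (if v = r then 1 else 0))"
      unfolding k_def bnd_diff bnd_indicator bnd_sum bnd_Z ..
    also have "(\<Sum>c\<in>ends e. (if v = c \<and> c \<noteq> a then 1 else 0) - s c * (if v = r then 1 else 0))
        = (\<Sum>c\<in>ends e. if v = c then (if v \<noteq> a then 1 else 0) else 0) - \<beta> e * (if v = r then 1 else 0)"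
      unfolding sum_subtractf \<beta>_def sum_distrib_right by (intro arg_cong2[where f = "(-)"] sum.cong) auto
    finally show ?thesis
      by (auto simp: \<alpha>_def)
  qed
  have k_at_a: "k e d = (if d = e then 1 else 0)" if "a \<in> ends d" for e d
    using that Z'(2) by (auto simp: k_def Z_def intro!: sum.neutral)
  \<comment> \<open>In the sum over all edges the chain \<open>Z c\<close> receives the coefficient
    \<open>bnd ends x c\<close>, which is 0.\<close>
  have x_eq: "x d = (\<Sum>e\<in>UNIV. x e * k e d)" for d
  proof -
    have "(\<Sum>e\<in>UNIV. \<Sum>c\<in>{c \<in> UNIV. c \<in> ends e}. x e * Z c d) = (\<Sum>c\<in>UNIV. \<Sum>e\<in>{e \<in> UNIV. c \<in> ends e}. x e * Z c d)"
      by (rule sum.swap_restrict) auto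
    also have "\<dots> = (\<Sum>c\<in>UNIV. bnd ends x c * Z c d)"
      by (simp add: bnd_def sum_distrib_right)
    also have "\<dots> = 0"
      by (simp add: x)
    finally have "(\<Sum>e\<in>UNIV. x e * (\<Sum>c\<in>ends e. Z c d)) = 0"
      by (simp add: sum_distrib_left)
    moreover have "(\<Sum>e\<in>UNIV. x e * (if d = e then 1 else 0)) = x d"
      by (simp add: if_distrib[of "\<lambda>c. _ * c"] cong: if_cong)
    ultimately show ?thesis
      by (simp add: k_def right_diff_distrib sum_subtractf)
  qed
  have "(\<Sum>e\<in>UNIV. x e * bnd ends (k e) v) = bnd ends x v" for v
  proof -
    have "bnd ends x v = bnd ends (\<lambda>d. \<Sum>e\<in>UNIV. x e * k e d) v"
      by (rule arg_cong[where f = "\<lambda>y. bnd ends y v"]) (rule ext, rule x_eq)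
    then show ?thesis
      by (simp add: bnd_sum bnd_scale)
  qed
  then have "(\<Sum>e\<in>UNIV. x e * bnd ends (k e) v) = 0" for v
    by (simp add: x)
  from this[of a] this[of r] have \<alpha>\<beta>: "(\<Sum>e\<in>UNIV. x e * \<alpha> e) = 0" "(\<Sum>e\<in>UNIV. x e * \<beta> e) = 0"
    using r by (simp_all add: bnd_k)
  \<comment> \<open>A correction with the same boundary turns \<open>k e\<close> into a lattice
    vector, and the corrections cancel in the combination weighted by \<open>x\<close>. As they are
    nonnegative on the edges at \<open>a\<close>, the only such edge that can keep a positive weight
    is \<open>e\<close>.\<close>
  have reduce: "x \<in> U" if W: "(\<Sum>e\<in>UNIV. x e * c e) = 0" "(\<Sum>e\<in>UNIV. x e * c' e) = 0"
      "\<And>e v. \<alpha> e * (if v = a then 1 else 0) + \<beta> e * (if v = r then 1 else 0)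
        = c e * bnd ends W v + c' e * bnd ends W' v"
      "\<And>e d. a \<in> ends d \<Longrightarrow> 0 \<le> c e * W d + c' e * W' d" for c c' W W'
  proof -
    define y where "y e d = k e d - c e * W d - c' e * W' d" for e d
    have "y e \<in> U" for e
    proof (rule low)
      show "bnd ends (y e) v = 0" for v
        using W(3)[of e v] unfolding y_def bnd_diff bnd_scale bnd_k by simp
      have "(\<Sum>d | a \<in> ends d. max (y e d) 0) \<le> (\<Sum>d | a \<in> ends d. if d = e then 1 else 0)"
      proof (rule sum_mono)
        fix d assume "d \<in> {d. a \<in> ends d}"
        then show "max (y e d) 0 \<le> (if d = e then 1 else 0)"
          using W(4)[of d e] by (simp add: y_def k_at_a)
      qed
      also have "\<dots> \<le> 1"
        by simp
      finally show "(\<Sum>d | a \<in> ends d. max (y e d) 0) \<le> 1" .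
    qed
    then have "(\<lambda>d. \<Sum>e\<in>UNIV. x e * y e d) \<in> U"
      by (intro int_submodule_sum[OF U] int_submodule_scale[OF U])
    moreover have "(\<Sum>e\<in>UNIV. x e * y e d) = x d" for d
    proof -
      have "(\<Sum>e\<in>UNIV. x e * y e d)
          = (\<Sum>e\<in>UNIV. x e * k e d) - (\<Sum>e\<in>UNIV. x e * c e) * W d - (\<Sum>e\<in>UNIV. x e * c' e) * W' d"
        by (simp add: y_def right_diff_distrib sum_subtractf sum_distrib_right mult.assoc)
      then show ?thesis
        using W(1,2) x_eq[of d] by simp
    qed
    ultimately show ?thesis
      by simp
  qed
  have \<beta>_at_a: "\<beta> e = 1 \<or> \<beta> e = - 1" if "a \<in> ends e" for e
  proof -
    obtain c where "ends e = {a, c}" "c \<noteq> a"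
      using simple_graph_other_end[OF G \<open>a \<in> ends e\<close>] by blast
    then show ?thesis
      using Z'(1) by (auto simp: \<beta>_def s_def)
  qed
  have \<beta>_off_a: "\<beta> e = 0 \<or> \<beta> e = 2 \<or> \<beta> e = - 2" if "a \<notin> ends e" for e
  proof -
    obtain b c where "ends e = {b, c}" "b \<noteq> c"
      using G unfolding simple_graph_def card_2_iff by blast
    moreover from this have "b \<noteq> a" "c \<noteq> a"
      using that by auto
    ultimately have "\<beta> e = s' b + s' c"
      by (simp add: \<beta>_def s_def)
    then show ?thesis
      using Z'(1)[OF \<open>b \<noteq> a\<close>] Z'(1)[OF \<open>c \<noteq> a\<close>] by presburger
  qed
  show ?thesis
  \<comment> \<open>An edge off \<open>a\<close> with \<open>\<beta>\<close> nonzero joins two ends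
    of equal sign and closes an odd walk in \<open>G - a\<close>. Without such an edge the signs are
    a proper 2-coloring of \<open>G - a\<close>.\<close>
  proof (cases "\<exists>e. a \<notin> ends e \<and> \<beta> e \<noteq> 0")
    case True
    then obtain e2 where e2: "a \<notin> ends e2" "\<beta> e2 \<noteq> 0"
      by blast
    \<comment> \<open>The parity corrector. Since \<open>\<beta> e2\<close> is 2 or -2, the factor
      is the sign that makes the boundary at \<open>r\<close> equal to 2.\<close>
    define T where "T d = (\<beta> e2 div 2) * k e2 d" for d
    have bnd_T: "bnd ends T v = 2 * (if v = r then 1 else 0)" for v
      using \<beta>_off_a[OF e2(1)] e2 unfolding T_def bnd_scale bnd_k by (auto simp: \<alpha>_def)
    \<comment> \<open>If no edge meets \<open>a\<close>, every \<open>\<alpha> e\<close> is 0, and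
      \<open>W = 0\<close>, \<open>b = 1\<close> are placeholders. Otherwise \<open>W\<close> comes
      from one fixed edge at \<open>a\<close>.\<close>
    obtain W b where W: "\<And>d. a \<in> ends d \<Longrightarrow> 0 \<le> W d"
        "\<And>v e. \<alpha> e * bnd ends W v = \<alpha> e * ((if v = a then 1 else 0) + b * (if v = r then 1 else 0))"
        "b = 1 \<or> b = - (1 :: int)"
    proof (cases "\<exists>e. a \<in> ends e")
      case True
      then obtain e1 where e1: "a \<in> ends e1"
        by blast
      show ?thesis
        using e1 \<beta>_at_a[OF e1] by (intro that[of "k e1" "\<beta> e1"]) (auto simp: bnd_k k_at_a \<alpha>_def)
    next
      case False
      then show ?thesis
        by (intro that[of "\<lambda>_. 0" 1]) (auto simp: \<alpha>_def)
    qed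
    \<comment> \<open>The division is exact: at \<open>a\<close> both \<open>\<beta> e\<close> and
      \<open>b\<close> are odd, and off \<open>a\<close> the value \<open>\<beta> e\<close> is
      even.\<close>
    define c' where "c' e = (\<beta> e - \<alpha> e * b) div 2" for e
    have c': "2 * c' e = \<beta> e - \<alpha> e * b" for e
      using \<beta>_at_a[of e] \<beta>_off_a[of e] W(3) by (auto simp: c'_def \<alpha>_def)
    have "2 * (\<Sum>e\<in>UNIV. x e * c' e) = (\<Sum>e\<in>UNIV. x e * (2 * c' e))"
      by (simp add: sum_distrib_left ac_simps)
    also have "\<dots> = (\<Sum>e\<in>UNIV. x e * \<beta> e) - (\<Sum>e\<in>UNIV. x e * \<alpha> e) * b"
      unfolding c' by (simp add: right_diff_distrib sum_subtractf sum_distrib_right mult.assoc)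
    also have "\<dots> = 0"
      by (simp add: \<alpha>\<beta>)
    finally have "(\<Sum>e\<in>UNIV. x e * c' e) = 0"
      by simp
    then show ?thesis
    proof (rule reduce[OF \<alpha>\<beta>(1)])
      show "\<alpha> e * (if v = a then 1 else 0) + \<beta> e * (if v = r then 1 else 0)
          = \<alpha> e * bnd ends W v + c' e * bnd ends T v" for e v
        using c'[of e] unfolding W(2) bnd_T by (simp add: algebra_simps)
      show "0 \<le> \<alpha> e * W d + c' e * T d" if "a \<in> ends d" for e d
        using that e2(1) W(1) by (auto simp: T_def k_at_a \<alpha>_def)
    qed
  next
    case False
    then have \<beta>_0: "\<beta> e = 0" if "a \<notin> ends e" for e
      using that by blast
    \<comment> \<open>The two parity classes of edges at \<open>a\<close>. Each edge is compared
      with a representative of its own class.\<close>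
    define c where "c t e = (if a \<in> ends e \<and> \<beta> e = t then 1 else 0 :: int)" for t e
    have "\<exists>W. (\<forall>d. a \<in> ends d \<longrightarrow> 0 \<le> W d) \<and>
        (\<forall>e v. c t e * bnd ends W v = c t e * ((if v = a then 1 else 0) + t * (if v = r then 1 else 0)))" for t
    proof (cases "\<exists>e. a \<in> ends e \<and> \<beta> e = t")
      case True
      then obtain e1 where "a \<in> ends e1" "\<beta> e1 = t"
        by blast
      then show ?thesis
        by (intro exI[of _ "k e1"]) (auto simp: bnd_k k_at_a \<alpha>_def)
    next
      case False
      then show ?thesis
        by (intro exI[of _ "\<lambda>_. 0"]) (auto simp: c_def)
    qed
    then obtain W where W: "\<And>t d. a \<in> ends d \<Longrightarrow> 0 \<le> W t d"
        "\<And>t e v. c t e * bnd ends (W t) v = c t e * ((if v = a then 1 else 0) + t * (if v = r then 1 else 0))"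
      by metis
    have c_eq: "2 * c 1 e = \<alpha> e + \<beta> e" "2 * c (- 1) e = \<alpha> e - \<beta> e" for e
      using \<beta>_0[of e] \<beta>_at_a[of e] by (auto simp: c_def \<alpha>_def)
    have two: "2 * (\<Sum>e\<in>UNIV. x e * c t e) = (\<Sum>e\<in>UNIV. x e * (2 * c t e))" for t
      by (simp add: sum_distrib_left ac_simps)
    have "(\<Sum>e\<in>UNIV. x e * c 1 e) = 0" "(\<Sum>e\<in>UNIV. x e * c (- 1) e) = 0"
      using two[of 1] two[of "- 1"] \<alpha>\<beta> unfolding c_eq
      by (simp_all add: distrib_left right_diff_distrib sum.distrib sum_subtractf)
    then show ?thesis
    proof (rule reduce)
      show "\<alpha> e * (if v = a then 1 else 0) + \<beta> e * (if v = r then 1 else 0)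
          = c 1 e * bnd ends (W 1) v + c (- 1) e * bnd ends (W (- 1)) v" for e v
        using c_eq[of e] unfolding W(2) by (auto simp: algebra_simps)
      show "0 \<le> c 1 e * W 1 d + c (- 1) e * W (- 1) d" if "a \<in> ends d" for e d
        using W(1)[OF that, of 1] W(1)[OF that, of "- 1"] by (auto simp: c_def)
    qed
  qed
qed

section \<open>Independent columns of the incidence matrix and the rank of the lattice\<close>

definition edges_independent :: "('e::finite \<Rightarrow> 'v set) \<Rightarrow> 'e set \<Rightarrow> bool" where
  "edges_independent ends Y \<longleftrightarrow>
    (\<forall>x. (\<forall>v. bnd ends x v = 0) \<and> (\<forall>e. e \<notin> Y \<longrightarrow> x e = 0) \<longrightarrow> (\<forall>e. x e = 0))"

text \<open>For a maximal independent \<open>Y\<close>, every edge outside \<open>Y\<close> has a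
  circuit vector in the lattice. These vectors form a diagonal matrix outside \<open>Y\<close>, so a
  spanning family needs at least as many members.\<close>

lemma card_independent_edges_ge:
  fixes ends :: "'e::finite \<Rightarrow> 'v::finite set"
  assumes "finite F" and span: "\<And>x. (\<And>v. bnd ends x v = 0) \<Longrightarrow> x \<in> int_comb F b"
  obtains Y where "edges_independent ends Y" "card (UNIV :: 'e set) - card Y \<le> card F"
proof -
  let ?ind = "edges_independent ends"
  have "{} \<in> {Y. ?ind Y}"
    by (auto simp: edges_independent_def)
  then obtain Y where Y: "?ind Y" "\<And>Z. ?ind Z \<Longrightarrow> Y \<subseteq> Z \<Longrightarrow> Y = Z"
    using finite_has_maximal[of "{Y. ?ind Y}"] by (metis empty_iff finite mem_Collect_eq)
  have "\<exists>x. (\<forall>v. bnd ends x v = 0) \<and> (\<forall>d. d \<notin> insert e Y \<longrightarrow> x d = 0) \<and> x e \<noteq> 0" if "e \<notin> Y" for e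
  proof -
    have "\<not> ?ind (insert e Y)"
      using Y(2)[of "insert e Y"] that by auto
    then obtain x d where x: "\<forall>v. bnd ends x v = 0" "\<forall>d. d \<notin> insert e Y \<longrightarrow> x d = 0" "x d \<noteq> 0"
      by (auto simp: edges_independent_def)
    then have "x e \<noteq> 0"
      using Y(1) unfolding edges_independent_def by (metis insertE)
    then show ?thesis
      using x by blast
  qed
  then obtain X where X: "\<And>e v. e \<notin> Y \<Longrightarrow> bnd ends (X e) v = 0"
      "\<And>e d. e \<notin> Y \<Longrightarrow> d \<notin> insert e Y \<Longrightarrow> X e d = 0" "\<And>e. e \<notin> Y \<Longrightarrow> X e e \<noteq> 0"
    by metis
  have "\<exists>c. \<forall>d. X e d = (\<Sum>g\<in>F. c g * b g d)" if "e \<notin> Y" for e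
    using span[of "X e"] X(1) that by (auto simp: int_comb_def)
  then obtain c where c: "\<And>e d. e \<notin> Y \<Longrightarrow> X e d = (\<Sum>g\<in>F. c e g * b g d)"
    by metis
  have "card (- Y) \<le> card F"
  proof (rule ccontr)
    assume "\<not> card (- Y) \<le> card F"
    then have "\<exists>m. (\<forall>e\<in>- Y. m e \<in> (UNIV :: int set)) \<and> (\<exists>e\<in>- Y. m e \<noteq> 0) \<and> (\<forall>g\<in>F. (\<Sum>e\<in>- Y. m e * c e g) = 0)"
      using \<open>finite F\<close> by (intro homogeneous_system_nontrivial_solution) (auto simp: subring_def)
    then obtain m d where m: "\<And>g. g \<in> F \<Longrightarrow> (\<Sum>e\<in>- Y. m e * c e g) = 0" "d \<notin> Y" "m d \<noteq> 0"
      by blast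
    have "(\<Sum>e\<in>- Y. m e * X e d) = (\<Sum>e\<in>- Y. \<Sum>g\<in>F. m e * c e g * b g d)"
      by (intro sum.cong refl) (simp add: c sum_distrib_left mult.assoc)
    also have "\<dots> = (\<Sum>g\<in>F. (\<Sum>e\<in>- Y. m e * c e g) * b g d)"
      by (subst sum.swap) (simp add: sum_distrib_right)
    also have "\<dots> = 0"
      by (simp add: m(1))
    also have "(\<Sum>e\<in>- Y. m e * X e d) = (\<Sum>e\<in>- Y. if e = d then m d * X d d else 0)"
      using X(2) m(2) by (intro sum.cong) auto
    also have "\<dots> = m d * X d d"
      using m(2) by simp
    finally show False
      using m(2,3) X(3) by auto
  qed
  then show thesis
    using Y(1) by (intro that[of Y]) (auto simp: edges_independent_def Compl_eq_Diff_UNIV card_Diff_subset)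
qed

text \<open>Independence makes \<open>toric_exp\<close> injective on monomials in \<open>Y\<close>,
  hence no terms can cancel.\<close>

lemma vars_in_Int_toric_ideal:
  fixes ends :: "'e::finite \<Rightarrow> 'v::finite set"
  assumes ind: "edges_independent ends Y"
  shows "vars_in Y \<inter> (toric_ideal ends :: ('e, 'k::field) mpol set) \<subseteq> {0}"
proof
  fix p :: "('e, 'k) mpol" assume "p \<in> vars_in Y \<inter> toric_ideal ends"
  then have p: "\<And>a. a \<in> keys p \<Longrightarrow> keys a \<subseteq> Y" "pushforward (toric_exp ends) p = 0"
    by (auto simp: vars_in_def toric_ideal_def toric_map_eq_pushforward)
  have inj: "s = t" if "s \<in> keys p" "t \<in> keys p" "toric_exp ends s = toric_exp ends t" for s t
  proof (rule poly_mapping_eqI)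
    fix e
    have off: "lookup s d = 0" "lookup t d = 0" if "d \<notin> Y" for d
      using that p(1) \<open>s \<in> keys p\<close> \<open>t \<in> keys p\<close> by (auto simp: subset_iff in_keys_iff)
    have "bnd ends (\<lambda>d. int (lookup s d) - int (lookup t d)) v = 0" for v
      using that(3) by (simp add: bnd_diff bnd_lookup)
    then have "int (lookup s e) - int (lookup t e) = 0"
      using ind off unfolding edges_independent_def
      by (auto dest!: spec[of _ "\<lambda>d. int (lookup s d) - int (lookup t d)"])
    then show "lookup s e = lookup t e"
      by simp
  qed
  have "lookup p t = 0" if "t \<in> keys p" for t
  proof -
    have "{s \<in> keys p. toric_exp ends s = toric_exp ends t} = {t}"
      using that inj by blast
    moreover have "(\<Sum>s\<in>{s \<in> keys p. toric_exp ends s = toric_exp ends t}. lookup p s) = 0"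
      using p(2) unfolding pushforward_eq_0_iff by blast
    ultimately show ?thesis
      by simp
  qed
  then show "p \<in> {0}"
    by (metis in_keys_iff keys_eq_empty equals0I singletonI)
qed

section \<open>Minimal generators of complete intersections\<close>

lemma minimal_generator_degree_le_1:
  fixes T :: "('e::finite, 'k::field) mpol set" and ends :: "'e \<Rightarrow> 'v::finite set"
  assumes G: "simple_graph ends" and ci: "complete_intersection ends TYPE('k)"
    and gen: "ideal_gen T = toric_ideal ends"
    and min: "\<And>g. g \<in> T \<Longrightarrow> g \<notin> ideal_gen (T - {g})"
    and hom: "\<And>g. g \<in> T \<Longrightarrow> \<exists>d. homogeneous d g"
    and pq: "\<And>g. g \<in> T \<Longrightarrow> g = monom (p g) - monom (q g)"
    and f: "f \<in> T" and conn: "connected_on ends (UNIV - {a})"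
  shows "lookup (toric_exp ends (p f)) a \<le> 1"
proof (rule ccontr)
  assume "\<not> ?thesis"
  then have deg_f: "2 \<le> lookup (toric_exp ends (p f)) a"
    by simp
  obtain S :: "('e, 'k) mpol set" where S: "finite S" "ideal_gen S = toric_ideal ends"
      "enat (card S) = height (toric_ideal ends :: ('e, 'k) mpol set)"
    using ci by (auto simp: complete_intersection_def)
  have T: "finite T" "card T \<le> card S"
    using minimal_homogeneous_generators_card_le[of S T] S gen hom min by auto
  let ?b = "\<lambda>g e. int (lookup (p g) e) - int (lookup (q g) e)"
  have span: "x \<in> int_comb (T - {f}) ?b" if "\<And>v. bnd ends x v = 0" for x
  proof (rule lattice_spanned_by_low_degree[OF G conn int_submodule_int_comb])
    fix y assume y: "\<And>v. bnd ends y v = 0" "(\<Sum>e | a \<in> ends e. max (y e) 0) \<le> 1"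
    \<comment> \<open>Positive and negative part of \<open>y\<close>.\<close>
    define u v where "u = Abs_poly_mapping (\<lambda>e. nat (y e))" and "v = Abs_poly_mapping (\<lambda>e. nat (- y e))"
    have u: "lookup u e = nat (y e)" and v: "lookup v e = nat (- y e)" for e
      by (simp_all add: u_def v_def)
    have diff: "(\<lambda>e. int (lookup u e) - int (lookup v e)) = y"
      by (simp add: fun_eq_iff u v)
    have "toric_exp ends u = toric_exp ends v"
    proof (rule poly_mapping_eqI)
      fix w
      have "int (lookup (toric_exp ends u) w) - int (lookup (toric_exp ends v) w)
          = bnd ends (\<lambda>e. int (lookup u e) - int (lookup v e)) w"
        by (simp only: bnd_diff bnd_lookup)
      then show "lookup (toric_exp ends u) w = lookup (toric_exp ends v) w"
        by (simp add: diff y(1))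
    qed
    moreover have "lookup (toric_exp ends u) a \<le> 1"
    proof -
      have "int (lookup (toric_exp ends u) a) = (\<Sum>e | a \<in> ends e. max (y e) 0)"
        unfolding lookup_toric_exp by (simp add: u max_def) (intro sum.cong, auto)
      then show ?thesis
        using y(2) by simp
    qed
    ultimately show "y \<in> int_comb (T - {f}) ?b"
      using low_degree_in_span[OF T(1) gen pq deg_f, of u v] unfolding diff by blast
  qed (rule that)
  obtain Y where Y: "edges_independent ends Y" "card (UNIV :: 'e set) - card Y \<le> card (T - {f})"
    using card_independent_edges_ge[of "T - {f}" ends ?b] T(1) span by auto
  have "vars_in Y \<inter> (toric_ideal ends :: ('e, 'k) mpol set) \<subseteq> {0}"
    by (rule vars_in_Int_toric_ideal[OF Y(1)])
  then have "enat (card S) \<le> enat (card (UNIV :: 'e set) - card Y)"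
    unfolding S(3) by (rule height_prime_le[OF prime_ideal_toric_ideal])
  then have "card T \<le> card (T - {f})"
    using T(2) Y(2) by simp
  then show False
    using T(1) f by (metis card_Diff1_less not_less)
qed

text \<open>If both factors were nontrivial, the binomial would be a combination of two binomials of
  smaller degree, and those already lie in the ideal of the other generators.\<close>

lemma minimal_binomial_indecomposable:
  fixes T :: "('e::finite, 'k::field) mpol set" and ends :: "'e \<Rightarrow> 'v::finite set"
  assumes G: "simple_graph ends" and gen: "ideal_gen T = toric_ideal ends"
    and hom: "\<And>g. g \<in> T \<Longrightarrow> \<exists>d. homogeneous d g"
    and min: "monom (u + u') - monom (v + v') \<notin> ideal_gen (T - {monom (u + u') - monom (v + v')})"
    and eq: "toric_exp ends u = toric_exp ends v" "toric_exp ends u' = toric_exp ends v'" and "u \<noteq> 0"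
  shows "u' = 0 \<and> v' = 0"
proof -
  let ?f = "monom (u + u') - monom (v + v') :: ('e, 'k) mpol"
  have tdeg: "tdeg u = tdeg v" "tdeg u' = tdeg v'"
    using toric_exp_eq_imp_tdeg_eq[OF G eq(1)] toric_exp_eq_imp_tdeg_eq[OF G eq(2)] .
  have f_hom: "homogeneous (tdeg (u + u')) ?f"
    using tdeg by (intro homogeneous_binomial) (auto simp: tdeg_add)
  have lower: "monom s - monom t \<in> ideal_gen (T - {?f})"
    if st: "toric_exp ends s = toric_exp ends t" "tdeg s < tdeg (u + u')" for s t
  proof -
    have "monom s - monom t \<in> ideal_gen T"
      using st(1) by (simp add: gen binomial_in_toric_ideal_iff)
    then have "hcomp (tdeg s) (monom s - monom t) \<in> ideal_gen (T - {?f})"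
      using hcomp_below_in_ideal_gen[OF hom f_hom] st(2) by blast
    moreover have "homogeneous (tdeg s) (monom s - monom t :: ('e, 'k) mpol)"
      using toric_exp_eq_imp_tdeg_eq[OF G st(1)] by (intro homogeneous_binomial) auto
    ultimately show ?thesis
      by (simp add: hcomp_homogeneous)
  qed
  have "u' = 0"
  proof (rule ccontr)
    assume "u' \<noteq> 0"
    then have "tdeg u < tdeg (u + u')" "tdeg u' < tdeg (u + u')"
      using \<open>u \<noteq> 0\<close> tdeg_eq_0_iff[of u] tdeg_eq_0_iff[of u'] by (simp_all add: tdeg_add)
    then have "monom u' * (monom u - monom v) + monom v * (monom u' - monom v') \<in> ideal_gen (T - {?f})"
      using lower eq
      by (intro is_ideal_add[OF is_ideal_ideal_gen] is_ideal_mult[OF is_ideal_ideal_gen]) auto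
    moreover have "monom u' * (monom u - monom v) + monom v * (monom u' - monom v') = ?f"
      by (simp add: monom_def right_diff_distrib mult_single add.commute)
    ultimately show False
      using min by simp
  qed
  then show ?thesis
    using tdeg(2) by (metis tdeg_eq_0_iff)
qed

section \<open>Cycle binomials and alternating cycles in two matchings\<close>

lemma B_cycle_eq_binomial:
  "B_cycle w = monom (\<Sum>i\<in>{i. i < length w \<and> even i}. single (w ! i) 1)
    - monom (\<Sum>i\<in>{i. i < length w \<and> odd i}. single (w ! i) 1)"
proof -
  have prod: "prod_list (map (\<lambda>i. Var (w ! i)) is) = monom (\<Sum>i\<leftarrow>is. single (w ! i) 1)" for "is"
    by (induction "is") (auto simp: monom_def Var_def mult_single)
  have sum: "(\<Sum>i\<leftarrow>filter P [0..<length w]. single (w ! i) (1::nat)) = (\<Sum>i\<in>{i. i < length w \<and> P i}. single (w ! i) 1)" for P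
    by (subst sum_list_distinct_conv_sum_set) (auto intro: sum.cong)
  show ?thesis
    unfolding B_cycle_def prod sum ..
qed

lemma lookup_sum_single_inj_on:
  "finite I \<Longrightarrow> inj_on w I \<Longrightarrow> lookup (\<Sum>i\<in>I. single (w i) (1::nat)) e = (if e \<in> w ` I then 1 else 0)"
proof -
  assume "finite I" "inj_on w I"
  then have "(\<Sum>i\<in>I. single (w i) (1::nat)) = (\<Sum>d\<in>w ` I. single d 1)"
    by (simp add: sum.reindex)
  then show ?thesis
    using \<open>finite I\<close> by (simp add: lookup_sum lookup_single when_def)
qed

text \<open>The degree bound makes \<open>u\<close> and \<open>v\<close> perfect matchings of the
  same set of vertices. A walk that uses them alternately is determined by its start and must close
  up.\<close>

lemma matchings_contain_even_cycle:
  fixes ends :: "'e::finite \<Rightarrow> 'v::finite set"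
  assumes G: "simple_graph ends" and eq: "toric_exp ends u = toric_exp ends v"
    and le_1: "\<And>x. lookup (toric_exp ends u) x \<le> 1" and "u \<noteq> v"
  obtains w u' v' where "even_cycle ends w"
    "u = (\<Sum>i\<in>{i. i < length w \<and> even i}. single (w ! i) 1) + u'"
    "v = (\<Sum>i\<in>{i. i < length w \<and> odd i}. single (w ! i) 1) + v'"
    "toric_exp ends (\<Sum>i\<in>{i. i < length w \<and> even i}. single (w ! i) 1)
      = toric_exp ends (\<Sum>i\<in>{i. i < length w \<and> odd i}. single (w ! i) 1)"
proof -
  define W where "W t = (if even t then u else v)" for t :: nat
  have W_exp: "toric_exp ends (W t) = toric_exp ends u" for t
    by (simp add: W_def eq)
  define covered where "covered x \<longleftrightarrow> lookup (toric_exp ends u) x = 1" for x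
  have covered: "covered x" if "x \<in> ends e" "0 < lookup (W t) e" for x e t
  proof -
    have "lookup (W t) e \<le> lookup (toric_exp ends (W t)) x"
      unfolding lookup_toric_exp using that(1) by (intro member_le_sum) auto
    then show ?thesis
      using that(2) le_1[of x] by (simp add: W_exp covered_def)
  qed
  have unique: "d = e" if "x \<in> ends d" "x \<in> ends e" "0 < lookup (W t) d" "0 < lookup (W t) e" for x d e t
  proof (rule ccontr)
    assume "d \<noteq> e"
    then have "lookup (W t) d + lookup (W t) e = (\<Sum>c\<in>{d, e}. lookup (W t) c)"
      by simp
    also have "\<dots> \<le> lookup (toric_exp ends (W t)) x"
      unfolding lookup_toric_exp using that(1,2) by (intro sum_mono2) auto
    finally show False
      using that(3,4) le_1[of x] by (simp add: W_exp)
  qed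
  define E where "E t x = (SOME e. x \<in> ends e \<and> 0 < lookup (W t) e)" for t x
  define Ot where "Ot t x = (SOME y. ends (E t x) = {x, y} \<and> y \<noteq> x)" for t x
  have EO: "0 < lookup (W t) (E t x)" "ends (E t x) = {x, Ot t x}" "Ot t x \<noteq> x" if "covered x" for t x
  proof -
    have "lookup (toric_exp ends (W t)) x \<noteq> 0"
      using that by (simp add: W_exp covered_def)
    then have "\<exists>e. x \<in> ends e \<and> 0 < lookup (W t) e"
      unfolding lookup_toric_exp by (auto elim: sum.not_neutral_contains_not_neutral)
    then have E: "x \<in> ends (E t x) \<and> 0 < lookup (W t) (E t x)"
      unfolding E_def by (rule someI_ex)
    then show "0 < lookup (W t) (E t x)" ..
    have "\<exists>y. ends (E t x) = {x, y} \<and> y \<noteq> x"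
      using simple_graph_other_end[OF G] E by blast
    then have "ends (E t x) = {x, Ot t x} \<and> Ot t x \<noteq> x"
      unfolding Ot_def by (rule someI_ex)
    then show "ends (E t x) = {x, Ot t x}" "Ot t x \<noteq> x"
      by auto
  qed
  have E_eqI: "E t x = e" if "x \<in> ends e" "0 < lookup (W t) e" for t x e
    using unique[of x "E t x" e t] EO[of x t] covered[OF that] that by auto
  have Ot_covered: "covered (Ot t x)" if "covered x" for t x
    using covered[of "Ot t x" "E t x" t] EO[OF that, of t] by auto
  have Ot_Ot: "Ot s (Ot t x) = x" if "covered x" "even s = even t" for s t x
  proof -
    have "E s (Ot t x) = E t x"
      using EO[OF that(1), of t] that(2) by (intro E_eqI) (auto simp: W_def)
    then show ?thesis
      using EO[OF that(1), of t] EO[OF Ot_covered[OF that(1), of t], of s] by (auto simp: doubleton_eq_iff)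
  qed
  have Ot_parity: "Ot s x = Ot t x" if "covered x" "even s = even t" for s t x
    by (metis Ot_Ot Ot_covered that)
  \<comment> \<open>If every edge of \<open>u\<close> were in \<open>v\<close>, then
    \<open>u\<close> would lie below \<open>v\<close>, and equal total degree would give
    equality.\<close>
  obtain e0 where e0: "0 < lookup u e0" "lookup v e0 = 0"
  proof (rule ccontr)
    assume neg: "\<not> thesis"
    have "lookup u e \<le> lookup v e" for e
    proof (cases "lookup u e = 0")
      case False
      then have "lookup v e \<noteq> 0"
        using neg that[of e] by auto
      moreover obtain x where "x \<in> ends e"
        using G unfolding simple_graph_def card_2_iff by blast
      then have "lookup u e \<le> lookup (toric_exp ends u) x"
        unfolding lookup_toric_exp by (intro member_le_sum) auto
      ultimately show ?thesis
        using le_1[of x] by linarith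
    qed simp
    moreover have "tdeg u = tdeg v"
      using toric_exp_eq_imp_tdeg_eq[OF G eq] .
    ultimately have "lookup u e = lookup v e" for e
      unfolding tdeg_def using sum_mono_inv[of "lookup u" UNIV "lookup v" e] by auto
    then show False
      using \<open>u \<noteq> v\<close> by (auto intro: poly_mapping_eqI)
  qed
  obtain x0 where x0: "x0 \<in> ends e0"
    using G unfolding simple_graph_def card_2_iff by blast
  define a where "a = rec_nat x0 Ot"
  have a_0: "a 0 = x0" and a_Suc: "a (Suc i) = Ot i (a i)" for i
    by (simp_all add: a_def)
  have cov: "covered (a i)" for i
    using covered[of x0 e0 0] x0 e0 by (induction i) (auto simp: a_0 a_Suc W_def Ot_covered)
  define es where "es i = E i (a i)" for i
  have es: "0 < lookup (W i) (es i)" "ends (es i) = {a i, a (Suc i)}" "a (Suc i) \<noteq> a i" for i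
    using EO[OF cov, of i i] by (auto simp: es_def a_Suc)
  have "\<not> inj a"
    using finite_imageD[of a UNIV] by auto
  then obtain i j where "i < j" "a i = a j"
    by (metis injI linorder_neqE_nat)
  then have ex: "\<exists>n. a n \<in> a ` {..<n}"
    by (metis imageI lessThan_iff)
  \<comment> \<open>The first time at which the walk meets a vertex again.\<close>
  define N where "N = (LEAST n. a n \<in> a ` {..<n})"
  have "a N \<in> a ` {..<N}"
    unfolding N_def using ex by (rule LeastI_ex)
  then obtain j where j: "j < N" "a N = a j"
    by auto
  have inj: "i = k" if "i < N" "k < N" "a i = a k" for i k
  proof (rule ccontr)
    have *: "a n \<notin> a ` {..<n}" if "n < N" for n
      using that unfolding N_def by (rule not_less_Least)
    assume "i \<noteq> k"
    then have "i < k \<or> k < i"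
      by auto
    then show False
      using *[OF that(1)] *[OF that(2)] that(3) by (metis imageI lessThan_iff)
  qed
  obtain M where M: "N = Suc M"
    using j(1) by (cases N) auto
  have Ot_last: "Ot M (a j) = a M"
    using Ot_Ot[OF cov, of M M M] j(2) by (simp add: M a_Suc)
  \<comment> \<open>With equal parities the last edge and the edge leaving \<open>a j\<close> would
    be the matching edge of the same vertex, so \<open>Suc j = M\<close>, against the
    parity.\<close>
  have parity: "even M \<noteq> even j"
  proof
    assume "even M = even j"
    then have "a M = a (Suc j)"
      using Ot_last Ot_parity[OF cov, of M j j] by (simp add: a_Suc)
    moreover have "j \<noteq> M"
      using es(3)[of M] j(2) M by auto
    ultimately have "Suc j = M"
      using inj[of "Suc j" M] j(1) M by auto
    then show False
      using \<open>even M = even j\<close> by auto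
  qed
  \<comment> \<open>Otherwise the edge entering \<open>a j\<close> has the parity of the last edge,
    so both come from the same vertex, although \<open>a\<close> does not repeat before
    \<open>N\<close>.\<close>
  have "j = 0"
  proof (rule ccontr)
    assume "j \<noteq> 0"
    then obtain i where i: "j = Suc i"
      by (cases j) auto
    then have "Ot M (a j) = a i"
      using Ot_Ot[OF cov, of M i i] parity by (simp add: a_Suc)
    then have "i = M"
      using Ot_last inj[of i M] i j(1) M by auto
    then show False
      using i j(1) M by simp
  qed
  then have evN: "even N" and a_N: "a N = a 0"
    using parity j(2) M by auto
  \<comment> \<open>A closed walk of length 2 would use \<open>e0\<close> in both matchings.\<close>
  have "N \<noteq> 2"
  proof
    assume "N = 2"
    then have "ends (es 1) = ends (es 0)"
      using es(2)[of 0] es(2)[of 1] a_N by (auto simp: numeral_2_eq_2)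
    then have "es 1 = es 0"
      using G by (auto simp: simple_graph_def inj_def)
    also have "es 0 = e0"
      unfolding es_def using x0 e0 by (intro E_eqI) (auto simp: a_0 W_def)
    finally show False
      using es(1)[of 1] e0(2) by (simp add: W_def)
  qed
  then have N4: "4 \<le> N"
    using evN j(1) by presburger
  define nx where "nx i = (i + 1) mod N" for i
  have nx: "nx i < N" "a (nx i) = a (Suc i)" "even (nx i) \<noteq> even i" if "i < N" for i
  proof -
    have "nx i = Suc i \<or> (nx i = 0 \<and> Suc i = N)"
      using that by (cases "Suc i = N") (auto simp: nx_def)
    then show "a (nx i) = a (Suc i)" "even (nx i) \<noteq> even i"
      using a_N evN by auto
    show "nx i < N"
      using N4 by (simp add: nx_def)
  qed
  have es_ends: "ends (es i) = {a i, a (nx i)}" if "i < N" for i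
    using es(2) nx(2)[OF that] by simp
  define w where "w = map es [0..<N]"
  have w: "length w = N" "\<And>i. i < N \<Longrightarrow> w ! i = es i"
    by (simp_all add: w_def)
  have "even_cycle ends w"
    unfolding even_cycle_def w(1)
  proof (intro conjI exI[of _ "map a [0..<N]"] allI impI)
    show "distinct (map a [0..<N])"
      using inj by (auto simp: distinct_map inj_on_def)
    show "ends (w ! i) = {map a [0..<N] ! i, map a [0..<N] ! ((i + 1) mod N)}" if "i < N" for i
      using es_ends[OF that] nx(1)[OF that] that by (simp add: w nx_def)
  qed (use evN N4 in auto)
  define I where "I t = {i. i < N \<and> even i = even t}" for t :: nat
  have inj_es: "inj_on es (I t)" for t
  proof (rule inj_onI)
    fix i k assume ik: "i \<in> I t" "k \<in> I t" "es i = es k"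
    then have lt: "i < N" "k < N" "even i = even k"
      by (auto simp: I_def)
    have "a i \<in> ends (es k)"
      using es(2)[of i] ik(3) by simp
    then have "a i = a k \<or> a i = a (nx k)"
      using es_ends[OF lt(2)] by simp
    then show "i = k"
      using inj[of i k] inj[of i "nx k"] nx[of k] lt by auto
  qed
  define m where "m t = (\<Sum>i\<in>I t. single (es i) (1::nat))" for t
  have lookup_m: "lookup (m t) e = (if e \<in> es ` I t then 1 else 0)" for t e
    unfolding m_def using inj_es by (intro lookup_sum_single_inj_on) (auto simp: I_def)
  have split: "W t = m t + (W t - m t)" for t
  proof (rule poly_mapping_eqI)
    fix e
    have "W i = W t" if "i \<in> I t" for i
      using that by (simp add: I_def W_def)
    then have "lookup (m t) e \<le> lookup (W t) e"
      using es(1) by (auto simp: lookup_m Suc_le_eq) metis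
    then show "lookup (W t) e = lookup (m t + (W t - m t)) e"
      by (simp add: lookup_add lookup_minus)
  qed
  \<comment> \<open>Each cycle vertex meets some cycle edge of the given parity, and at most one
    because \<open>m t\<close> is bounded by the matching \<open>W t\<close>.\<close>
  have m_exp: "lookup (toric_exp ends (m t)) x = (if x \<in> a ` {..<N} then 1 else 0)" for t x
  proof (cases "x \<in> a ` {..<N}")
    case True
    then obtain k where k: "k < N" "x = a k"
      by auto
    have "\<exists>i\<in>I t. x \<in> ends (es i)"
    proof (cases "even k = even t")
      case True
      then show ?thesis
        using k es(2)[of k] by (auto simp: I_def)
    next
      case False
      \<comment> \<open>The cyclic predecessor of \<open>k\<close>. It has the other parity, also
        across the wrap-around, because \<open>N\<close> is even.\<close>
      define i where "i = (if k = 0 then N - 1 else k - 1)"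
      have "i < N" "even i = even t" "a (Suc i) = a k"
        using False k(1) evN N4 a_N by (auto simp: i_def)
      then show ?thesis
        using k es(2)[of i] by (auto simp: I_def)
    qed
    then obtain i where i: "i \<in> I t" "x \<in> ends (es i)"
      by blast
    then have "lookup (m t) (es i) \<le> lookup (toric_exp ends (m t)) x"
      unfolding lookup_toric_exp by (intro member_le_sum) auto
    moreover have "lookup (toric_exp ends (m t)) x \<le> lookup (toric_exp ends (W t)) x"
      using toric_exp_add[of ends "m t" "W t - m t"] split[of t] by (metis lookup_add le_add1)
    ultimately show ?thesis
      using True le_1[of x] i(1) by (simp add: lookup_m W_exp)
  next
    case False
    have "x \<notin> ends (es i)" if "i \<in> I t" for i
      using that False es_ends[of i] nx(1)[of i] by (auto simp: I_def)
    then have "lookup (toric_exp ends (m t)) x = 0"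
      unfolding lookup_toric_exp by (intro sum.neutral) (auto simp: lookup_m)
    then show ?thesis
      using False by simp
  qed
  have m_w: "(\<Sum>i\<in>{i. i < length w \<and> even i}. single (w ! i) 1) = m 0"
    "(\<Sum>i\<in>{i. i < length w \<and> odd i}. single (w ! i) 1) = m 1"
    unfolding m_def by (auto simp: I_def w intro!: sum.cong)
  show thesis
  proof (rule that[of w "u - m 0" "v - m 1"], unfold m_w)
    show "u = m 0 + (u - m 0)" "v = m 1 + (v - m 1)"
      using split[of 0] split[of 1] by (simp_all add: W_def)
    show "toric_exp ends (m 0) = toric_exp ends (m 1)"
      by (rule poly_mapping_eqI) (simp add: m_exp)
  qed fact
qed

theorem theorem5p3:
  fixes ends :: "'e::finite \<Rightarrow> 'v::finite set"
    and f :: "('e, 'k::field) mpol"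
  assumes "simple_graph ends"
    and "biconnected ends"
    and "complete_intersection ends TYPE('k)"
    and "minimal_generator ends f"
  shows "\<exists>w. even_cycle ends w \<and> (f = B_cycle w \<or> f = - B_cycle w)"
proof -
  obtain T where T: "f \<in> T" "\<forall>g\<in>T. is_binomial g" "ideal_gen T = toric_ideal ends"
      "\<forall>T'. T' \<subset> T \<longrightarrow> ideal_gen T' \<noteq> toric_ideal ends"
    using assms(4) unfolding minimal_generator_def by (elim exE conjE)
  obtain p q where pq: "\<And>g. g \<in> T \<Longrightarrow> g = monom (p g) - monom (q g)"
    using T(2) unfolding is_binomial_def by metis
  have min: "g \<notin> ideal_gen (T - {g})" if "g \<in> T" for g
  proof
    assume "g \<in> ideal_gen (T - {g})"
    then have "T \<subseteq> ideal_gen (T - {g})"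
      using subset_ideal_gen[of "T - {g}"] by blast
    then have "ideal_gen T \<subseteq> ideal_gen (T - {g})"
      by (rule ideal_gen_least[OF is_ideal_ideal_gen])
    moreover have "ideal_gen (T - {g}) \<subseteq> ideal_gen T"
      using subset_ideal_gen[of T] by (intro ideal_gen_least[OF is_ideal_ideal_gen]) blast
    ultimately have "ideal_gen (T - {g}) = toric_ideal ends"
      using T(3) by simp
    moreover have "T - {g} \<subset> T"
      using that by blast
    ultimately show False
      using T(4) by simp
  qed
  have exp_eq: "toric_exp ends (p g) = toric_exp ends (q g)" if "g \<in> T" for g
  proof -
    have "monom (p g) - monom (q g) \<in> (toric_ideal ends :: ('e, 'k) mpol set)"
      using subset_ideal_gen[of T] that unfolding T(3) pq[OF that, symmetric] by blast
    then show ?thesis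
      by (simp add: binomial_in_toric_ideal_iff)
  qed
  have hom: "\<exists>d. homogeneous d g" if "g \<in> T" for g
    using homogeneous_binomial[of "p g" _ "q g"] pq[OF that]
      toric_exp_eq_imp_tdeg_eq[OF assms(1) exp_eq[OF that]] by metis
  have "connected_on ends (UNIV - {a})" for a
    using assms(2) by (simp add: biconnected_def cut_vertex_def)
  then have le_1: "lookup (toric_exp ends (p f)) a \<le> 1" for a
    using minimal_generator_degree_le_1[OF assms(1,3) T(3) min hom pq T(1)] by blast
  have "p f \<noteq> q f"
    using min[OF T(1)] pq[OF T(1)] is_ideal_zero[OF is_ideal_ideal_gen] by (metis diff_self)
  let ?m = "\<lambda>P w. \<Sum>i\<in>{i. i < length w \<and> P i}. single (w ! i) (1::nat)"
  obtain w u' v' where w: "even_cycle ends w"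
      "p f = ?m even w + u'" "q f = ?m odd w + v'" "toric_exp ends (?m even w) = toric_exp ends (?m odd w)"
    by (rule matchings_contain_even_cycle[OF assms(1) exp_eq[OF T(1)] le_1 \<open>p f \<noteq> q f\<close>])
  have f: "f = monom (?m even w + u') - monom (?m odd w + v')"
    using pq[OF T(1)] w(2,3) by simp
  have "monom (?m even w + u') - monom (?m odd w + v')
      \<notin> ideal_gen (T - {monom (?m even w + u') - monom (?m odd w + v')})"
    unfolding f[symmetric] by (rule min[OF T(1)])
  moreover have "toric_exp ends u' = toric_exp ends v'"
    using exp_eq[OF T(1)] w(4) unfolding w(2,3) toric_exp_add by simp
  \<comment> \<open>This excludes the trivial splitting, so indecomposability forces the rest
    \<open>u'\<close>, \<open>v'\<close> to vanish.\<close>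
  moreover have "?m even w \<noteq> 0"
  proof -
    have "0 < length w"
      using w(1) by (auto simp: even_cycle_def)
    then have "lookup (single (w ! 0) 1) (w ! 0) \<le> lookup (?m even w) (w ! 0)"
      unfolding lookup_sum by (intro member_le_sum) auto
    then show ?thesis
      by auto
  qed
  ultimately have "u' = 0 \<and> v' = 0"
    using minimal_binomial_indecomposable[OF assms(1) T(3) hom _ w(4)] by blast
  then have "f = B_cycle w"
    using f by (simp add: B_cycle_eq_binomial)
  then show ?thesis
    using w(1) by blast
qed

end
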